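(* Let $R$ be a commutative unital ring and let $M$ be a finitely generated non-cyclic $R$-module with finite dual Goldie dimension, such that the residue fields $R/\mathfrak{m}$ are infinite for all $\mathfrak{m}\in S_M$. Equip $M$ with the induced Zariski topology. Then $\sigma_{\tau}(M,R)=\min_{\mathfrak{m}\in S_M}|R/\mathfrak{m}|+1$. Consequently, (a) the induced Zariski topology on $M$ makes it into a $\kappa_M$-maximal Baire space, for $\kappa_M=\min_{\mathfrak{m}\in S_M}|R/\mathfrak{m}|+1$; and (b) the covering number of $M$ is $\sigma(M,R)=\kappa_M$.
   Context: $\mathrm{mSpec}(R)$ is the set of maximal ideals of $R$, and $S_M=\{\mathfrak{m}\in\mathrm{mSpec}(R):\dim_{R/\mathfrak{m}}(M/\mathfrak{m}M)\ge 2\}$. The dual Goldie dimension (hollow dimension, corank) of $M$ is the supremum of the integers $n\ge0$ for which there is a surjective $R$-linear map from $M$ onto a product $N_1\times\cdots\times N_n$ of $n$ nonzero $R$-modules. Induced Zariski topology on a finite-dimensional vector space $V$ over a field $\mathbf{K}$: identify $V$ with $\mathbf{K}^n$ by a basis; closed sets are the common zero sets of families of polynomials in $\mathbf{K}[X_1,\dots,X_n]$ (independent of the basis). Induced Zariski topology on a finitely generated $R$-module $M$: topologize each $M/\mathfrak{m}M$ with the induced Zariski topology as an $R/\mathfrak{m}$-vector space if $\mathfrak{m}\in S_M$, and with the topology whose only closed sets are $\emptyset,\{0\},M/\mathfrak{m}M$ if $\mathfrak{m}\notin S_M$; give $\prod_{\mathfrak{m}\in\mathrm{mSpec}(R)}M/\mathfrak{m}M$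 the product topology; and give $M$ the coarsest topology making $q:M\to\prod_{\mathfrak{m}\in\mathrm{mSpec}(R)}M/\mathfrak{m}M$, $q(x)=(x+\mathfrak{m}M)_{\mathfrak{m}}$, continuous. (When $M$ has finite dual Goldie dimension only finitely many factors $M/\mathfrak{m}M$ are nonzero.) $\sigma(M,R)$ is the minimum cardinal number of proper $R$-submodules of $M$ whose union is $M$; $\sigma_\tau(M,R)$ is the minimum cardinal number of proper closed subsets of $M$ (induced Zariski topology) whose union is $M$. For a cardinal $\kappa$, a space $X$ is a $\kappa$-Baire space if for every collection $\{\mathcal{O}_i\}_{i\in I}$ of dense open subsets of $X$ with $|I|<\kappa$, the intersection $\bigcap_{i\in I}\mathcal{O}_i$ is dense in $X$. $X$ is a $\kappa$-maximal Baire space if it is a $\kappa$-Baire space but is not an $\aleph$-Baire space for any cardinal $\aleph>\kappa$. *)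

theory Defs
  imports
    "HOL-Library.Extended_Nat"
    "HOL-Analysis.Function_Topology"
    "HOL-Algebra.Indexed_Polynomials"
    "Jordan_Normal_Form.Missing_VectorSpace"
begin

unbundle cardinal_syntax

section \<open>Modules\<close>

definition module_fg :: "('a, 'r) ring_scheme \<Rightarrow> ('a, 'b, 'm) module_scheme \<Rightarrow> bool" where
  "module_fg R M \<longleftrightarrow>
     (\<exists>A. finite A \<and> A \<subseteq> carrier M \<and> LinearCombinations.module.span R M A = carrier M)"

definition module_cyclic :: "('a, 'r) ring_scheme \<Rightarrow> ('a, 'b, 'm) module_scheme \<Rightarrow> bool" where
  "module_cyclic R M \<longleftrightarrow>
     (\<exists>x \<in> carrier M. LinearCombinations.module.span R M {x} = carrier M)"

text \<open>The multiplicative fields of a module record (inherited from rings) carry no meaning.\<close>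

definition prod_module :: "'i set \<Rightarrow> ('i \<Rightarrow> ('a, 'b) module) \<Rightarrow> ('a, 'i \<Rightarrow> 'b) module" where
  "prod_module I N =
     \<lparr>carrier = (\<Pi>\<^sub>E i\<in>I. carrier (N i)), monoid.mult = undefined, one = undefined,
      zero = (\<lambda>i\<in>I. \<zero>\<^bsub>N i\<^esub>),
      add = (\<lambda>f g. \<lambda>i\<in>I. f i \<oplus>\<^bsub>N i\<^esub> g i),
      smult = (\<lambda>a f. \<lambda>i\<in>I. a \<odot>\<^bsub>N i\<^esub> f i)\<rparr>"

text \<open>
  The factors are taken with carriers in \<open>'b set\<close>. This is no restriction: each factor is a
  quotient of \<open>M\<close>, hence isomorphic to a module whose elements are cosets in \<open>M\<close>.
\<close>

definition surjects_onto_nonzero_factors ::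
    "('a, 'r) ring_scheme \<Rightarrow> ('a, 'b, 'm) module_scheme \<Rightarrow> nat \<Rightarrow> bool" where
  "surjects_onto_nonzero_factors R M n \<longleftrightarrow>
     (\<exists>(N :: nat \<Rightarrow> ('a, 'b set) module) f.
        (\<forall>i<n. Module.module R (N i) \<and> carrier (N i) \<noteq> {\<zero>\<^bsub>N i\<^esub>}) \<and>
        f \<in> module_hom R M (prod_module {..<n} N) \<and>
        f ` carrier M = carrier (prod_module {..<n} N))"

definition dual_Goldie_dim :: "('a, 'r) ring_scheme \<Rightarrow> ('a, 'b, 'm) module_scheme \<Rightarrow> enat" where
  "dual_Goldie_dim R M = Sup {enat n |n. surjects_onto_nonzero_factors R M n}"

section \<open>The fibres \<open>M/\<mm>M\<close>\<close>

definition mSpec :: "('a, 'r) ring_scheme \<Rightarrow> 'a set set" where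
  "mSpec R = {\<mm>. maximalideal \<mm> R}"

definition ideal_smult ::
    "('a, 'r) ring_scheme \<Rightarrow> ('a, 'b, 'm) module_scheme \<Rightarrow> 'a set \<Rightarrow> 'b set" where
  "ideal_smult R M I =
     LinearCombinations.module.span R M {a \<odot>\<^bsub>M\<^esub> x |a x. a \<in> I \<and> x \<in> carrier M}"

text \<open>
  The quotient \<open>M/IM\<close> as a module over \<open>R/I\<close>. Scalars and vectors are cosets, and the action is
  defined through all representatives, in the manner of \<^const>\<open>rcoset_mult\<close>.
\<close>

definition fibre ::
    "('a, 'r) ring_scheme \<Rightarrow> ('a, 'b, 'm) module_scheme \<Rightarrow> 'a set \<Rightarrow> ('a set, 'b set) module" where
  "fibre R M I =
     \<lparr>carrier = a_rcosets\<^bsub>M\<^esub> (ideal_smult R M I), monoid.mult = undefined, one = undefined,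
      zero = ideal_smult R M I, add = set_add M,
      smult = (\<lambda>A Y. \<Union>a\<in>A. \<Union>x\<in>Y. ideal_smult R M I +>\<^bsub>M\<^esub> (a \<odot>\<^bsub>M\<^esub> x))\<rparr>"

text \<open>
  \<^const>\<open>vectorspace.dim\<close> is meaningful for finite-dimensional spaces only; it is used here for
  finitely generated \<open>M\<close>, where all fibres are finite-dimensional.
\<close>

definition S_set :: "('a, 'r) ring_scheme \<Rightarrow> ('a, 'b, 'm) module_scheme \<Rightarrow> 'a set set" where
  "S_set R M = {\<mm> \<in> mSpec R. vectorspace.dim (R Quot \<mm>) (fibre R M \<mm>) \<ge> 2}"

section \<open>The induced Zariski topology\<close>

text \<open>
  Elements of \<^const>\<open>ring.indexed_pset\<close> are coefficient functions on monomials, a monomial being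
  the multiset of its variables with multiplicity.
\<close>

definition indexed_poly_eval ::
    "('k, 'r) ring_scheme \<Rightarrow> ('i multiset \<Rightarrow> 'k) \<Rightarrow> ('i \<Rightarrow> 'k) \<Rightarrow> 'k" where
  "indexed_poly_eval K P x =
     (\<Oplus>\<^bsub>K\<^esub>m\<in>{m. P m \<noteq> \<zero>\<^bsub>K\<^esub>}. P m \<otimes>\<^bsub>K\<^esub> (\<Otimes>\<^bsub>K\<^esub>i\<in>set_mset m. x i [^]\<^bsub>K\<^esub> count m i))"

definition coordinates :: "('k, 'r) ring_scheme \<Rightarrow> ('k, 'v, 'm) module_scheme \<Rightarrow> 'v set \<Rightarrow> 'v \<Rightarrow> 'v \<Rightarrow> 'k"
  where
  "coordinates K V B v =
     (THE c. c \<in> B \<rightarrow>\<^sub>E carrier K \<and> LinearCombinations.module.lincomb V c B = v)"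

text \<open>A basis \<open>B\<close> identifies \<open>V\<close> with \<open>K\<^sup>B\<close>; the variables of the polynomials are indexed by \<open>B\<close>.\<close>

definition zariski_closed ::
    "('k, 'r) ring_scheme \<Rightarrow> ('k, 'v, 'm) module_scheme \<Rightarrow> 'v set \<Rightarrow> 'v set \<Rightarrow> bool" where
  "zariski_closed K V B Z \<longleftrightarrow>
     (\<exists>F \<subseteq> ring.indexed_pset K B (carrier K).
        Z = {v \<in> carrier V. \<forall>P\<in>F. indexed_poly_eval K P (coordinates K V B v) = \<zero>\<^bsub>K\<^esub>})"

definition zariski_topology ::
    "('k, 'r) ring_scheme \<Rightarrow> ('k, 'v, 'm) module_scheme \<Rightarrow> 'v topology" where
  "zariski_topology K V =
     (let B = (SOME B. vectorspace.basis K V B)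
      in topology (\<lambda>U. U \<subseteq> carrier V \<and> zariski_closed K V B (carrier V - U)))"

definition fibre_topology ::
    "('a, 'r) ring_scheme \<Rightarrow> ('a, 'b, 'm) module_scheme \<Rightarrow> 'a set \<Rightarrow> 'b set topology" where
  "fibre_topology R M \<mm> =
     (let V = fibre R M \<mm> in
      if \<mm> \<in> S_set R M then zariski_topology (R Quot \<mm>) V
      else topology (\<lambda>U. U \<subseteq> carrier V \<and> carrier V - U \<in> {{}, {\<zero>\<^bsub>V\<^esub>}, carrier V}))"

definition induced_zariski ::
    "('a, 'r) ring_scheme \<Rightarrow> ('a, 'b, 'm) module_scheme \<Rightarrow> 'b topology" where
  "induced_zariski R M =
     pullback_topology (carrier M)
       (\<lambda>x. \<lambda>\<mm>\<in>mSpec R. ideal_smult R M \<mm> +>\<^bsub>M\<^esub> x)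
       (product_topology (fibre_topology R M) (mSpec R))"

section \<open>Cardinals\<close>

text \<open>The least cardinality of a member of \<open>\<A>\<close>, for nonempty \<open>\<A>\<close>.\<close>

definition min_card :: "'x set set \<Rightarrow> 'x rel" where
  "min_card \<A> = |SOME A. A \<in> \<A> \<and> (\<forall>B\<in>\<A>. |A| \<le>o |B| )|"

lemma min_card:
  assumes "\<A> \<noteq> {}"
  shows "\<exists>A\<in>\<A>. min_card \<A> = |A|" and "\<And>B. B \<in> \<A> \<Longrightarrow> min_card \<A> \<le>o |B|"
proof -
  have "\<exists>r \<in> card_of ` \<A>. \<forall>r' \<in> card_of ` \<A>. r \<le>o r'"
    using assms by (intro exists_minim_Card_order) (auto simp: card_of_Card_order)
  then have "\<exists>A. A \<in> \<A> \<and> (\<forall>B\<in>\<A>. |A| \<le>o |B| )" by blast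
  from someI_ex[OF this]
  show "\<exists>A\<in>\<A>. min_card \<A> = |A|" and "\<And>B. B \<in> \<A> \<Longrightarrow> min_card \<A> \<le>o |B|"
    unfolding min_card_def by blast+
qed

definition submodule_covers ::
    "('a, 'r) ring_scheme \<Rightarrow> ('a, 'b, 'm) module_scheme \<Rightarrow> 'b set set set" where
  "submodule_covers R M =
     {\<C>. (\<forall>N\<in>\<C>. Module.submodule N R M \<and> N \<noteq> carrier M) \<and> \<Union>\<C> = carrier M}"

definition closed_covers ::
    "('a, 'r) ring_scheme \<Rightarrow> ('a, 'b, 'm) module_scheme \<Rightarrow> 'b set set set" where
  "closed_covers R M =
     {\<C>. (\<forall>Z\<in>\<C>. closedin (induced_zariski R M) Z \<and> Z \<noteq> carrier M) \<and> \<Union>\<C> = carrier M}"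

definition covering_number ::
    "('a, 'r) ring_scheme \<Rightarrow> ('a, 'b, 'm) module_scheme \<Rightarrow> 'b set rel" where
  "covering_number R M = min_card (submodule_covers R M)"

definition closed_covering_number ::
    "('a, 'r) ring_scheme \<Rightarrow> ('a, 'b, 'm) module_scheme \<Rightarrow> 'b set rel" where
  "closed_covering_number R M = min_card (closed_covers R M)"

definition kappa :: "('a, 'r) ring_scheme \<Rightarrow> ('a, 'b, 'm) module_scheme \<Rightarrow> ('a set + unit) rel" where
  "kappa R M = min_card ((\<lambda>\<mm>. carrier (R Quot \<mm>)) ` S_set R M) +c cone"

section \<open>Baire spaces\<close>

definition cardinal_Baire :: "'k rel \<Rightarrow> 'x topology \<Rightarrow> bool" where
  "cardinal_Baire \<kappa> T \<longleftrightarrow>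
     (\<forall>\<O>. (\<forall>U\<in>\<O>. openin T U \<and> T closure_of U = topspace T) \<and> |\<O>| <o \<kappa>
        \<longrightarrow> T closure_of (topspace T \<inter> \<Inter>\<O>) = topspace T)"

text \<open>
  The cardinals \<open>\<mu>\<close> range over the type \<open>'k set\<close>, which contains the successor of \<open>\<kappa>\<close>. As the
  property is antitone in the cardinal, this covers the cardinals above \<open>\<kappa>\<close> on every type; see
  the lemma below.
\<close>

definition maximal_cardinal_Baire :: "'k rel \<Rightarrow> 'x topology \<Rightarrow> bool" where
  "maximal_cardinal_Baire \<kappa> T \<longleftrightarrow>
     cardinal_Baire \<kappa> T \<and>
     (\<forall>\<mu> :: 'k set rel. Card_order \<mu> \<and> \<kappa> <o \<mu> \<longrightarrow> \<not> cardinal_Baire \<mu> T)"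

lemma maximal_cardinal_Baire_not_Baire:
  fixes \<kappa> :: "'k rel" and \<mu> :: "'l rel"
  assumes "maximal_cardinal_Baire \<kappa> T" "Card_order \<kappa>" "Card_order \<mu>" "\<kappa> <o \<mu>"
  shows "\<not> cardinal_Baire \<mu> T"
proof
  assume "cardinal_Baire \<mu> T"
  moreover have "cardSuc \<kappa> \<le>o \<mu>"
    using assms by (intro cardSuc_least)
  ultimately have "cardinal_Baire (cardSuc \<kappa>) T"
    unfolding cardinal_Baire_def using ordLess_ordLeq_trans by blast
  moreover have "Card_order (cardSuc \<kappa>)" "\<kappa> <o cardSuc \<kappa>"
    using assms(2) by (auto intro: cardSuc_Card_order cardSuc_greater)
  ultimately show False
    using assms(1) unfolding maximal_cardinal_Baire_def by blast
qed

end

theory Submission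
  imports Defs
begin

text \<open>
  Let \<open>\<lambda>\<close> be the least cardinality of a residue field \<open>R/\<mm>\<close> with \<open>\<mm>\<close> in \<open>S_set R M\<close>. As \<open>\<lambda>\<close> is
  infinite, \<open>kappa R M\<close> is \<open>\<lambda> + 1 = \<lambda>\<close>. Everything follows from one lower bound and one upper bound.

  The lower bound says that fewer than \<open>\<lambda>\<close> proper closed subsets never cover \<open>M\<close>. In a single fibre
  at \<open>\<mm> \<in> S_set R M\<close> this is a statement about polynomials: over an infinite field \<open>K\<close>, fewer than
  \<open>|K|\<close> nonzero polynomial functions in finitely many variables have a common nonzero
  (\<open>ex_common_nonzero\<close>, by induction on the number of variables). In a fibre of dimension one all
  proper closed sets together contain at most the origin. To pass to \<open>M\<close>, note that the complement
  of a proper closed set \<open>Z\<close> contains a nonempty basic open box of the product, so that each point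
  of \<open>Z\<close> lies, in some fibre, in a proper closed set that depends on \<open>Z\<close> and on the fibre only
  (\<open>proper_closed_set_in_fibres\<close>). Finite dual Goldie dimension leaves only finitely many nonzero
  fibres, because the Chinese remainder theorem maps \<open>M\<close> onto the product of any finite number of
  them. By the same theorem, points chosen outside the bad sets of each nonzero fibre come from one
  point of \<open>M\<close>, and that point is not covered (\<open>few_closed_sets_do_not_cover\<close>).

  For the upper bound, two independent linear forms \<open>\<phi>\<close> and \<open>\<psi>\<close> on a fibre of dimension at least two
  give the submodules \<open>\<psi> = k\<phi>\<close>, for \<open>k\<close> in the residue field, and \<open>\<phi> = 0\<close>. They cover \<open>M\<close> like the
  lines through the origin cover the plane (\<open>submodule_cover_of_residue_cardinality\<close>). Covers by
  submodules and covers by closed sets are compared through maximal submodules: in a finitely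
  generated module a proper submodule lies in a maximal one, and a maximal submodule is the
  preimage of a hyperplane of some fibre and so is closed (\<open>closedin_maximal_submodule\<close>).

  The set \<open>S_set R M\<close> is nonempty since otherwise an element that is nonzero in each nonzero fibre
  would generate \<open>M\<close> (\<open>S_set_nonempty\<close>). The Baire property is a rewording of the two bounds. The
  lower bound makes the space irreducible, so that the dense open sets are the nonempty ones. The
  intersection of fewer than \<open>\<lambda>\<close> of them meets every nonempty open set, while the complements of the
  members of a closed cover of size \<open>\<lambda>\<close> have empty intersection.
\<close>

section \<open>Polynomial functions\<close>

definition monomial_eval :: "('k, 'r) ring_scheme \<Rightarrow> 'i multiset \<Rightarrow> ('i \<Rightarrow> 'k) \<Rightarrow> 'k" where
  "monomial_eval K m x = (\<Otimes>\<^bsub>K\<^esub>i\<in>set_mset m. x i [^]\<^bsub>K\<^esub> count m i)"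

text \<open>
  Only the values at points with coordinates in the carrier count, so that closure properties can be
  proved for functions, without identities between coefficients.
\<close>

definition polynomial_on :: "('k, 'r) ring_scheme \<Rightarrow> 'i set \<Rightarrow> (('i \<Rightarrow> 'k) \<Rightarrow> 'k) \<Rightarrow> bool" where
  "polynomial_on K B f \<longleftrightarrow>
     (\<exists>P \<in> ring.indexed_pset K B (carrier K). \<forall>x \<in> B \<rightarrow> carrier K. f x = indexed_poly_eval K P x)"

context cring
begin

lemma monomial_eval_closed:
  assumes "x \<in> B \<rightarrow> carrier R" "set_mset m \<subseteq> B"
  shows "monomial_eval R m x \<in> carrier R"
  unfolding monomial_eval_def using assms by (intro finprod_closed) (auto intro!: nat_pow_closed)

lemma monomial_eval_add_mset:
  assumes x: "x \<in> B \<rightarrow> carrier R" and m: "set_mset m \<subseteq> B" and i: "i \<in> B"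
  shows "monomial_eval R (add_mset i m) x = monomial_eval R m x \<otimes> x i"
proof -
  have xi: "x j \<in> carrier R" if "j \<in> B" for j using x that by auto
  define A where "A = set_mset m - {i}"
  define p where "p = (\<Otimes>j\<in>A. x j [^] count m j)"
  have A: "finite A" "i \<notin> A" "A \<subseteq> B" using m by (auto simp: A_def)
  have p: "p \<in> carrier R" unfolding p_def using A by (intro finprod_closed) (auto intro!: nat_pow_closed xi)
  have 1: "monomial_eval R m x = (x i [^] count m i) \<otimes> p"
  proof (cases "i \<in># m")
    case True
    then have "set_mset m = insert i A" by (auto simp: A_def)
    then show ?thesis unfolding monomial_eval_def p_def using A i
      by (auto intro!: finprod_insert nat_pow_closed xi)
  next
    case False
    then have "set_mset m = A" "count m i = 0" by (auto simp: A_def not_in_iff)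
    then show ?thesis unfolding monomial_eval_def p_def[symmetric] using p by (simp add: p_def)
  qed
  have "set_mset (add_mset i m) = insert i A" by (auto simp: A_def)
  then have "monomial_eval R (add_mset i m) x =
      (x i [^] Suc (count m i)) \<otimes> (\<Otimes>j\<in>A. x j [^] count (add_mset i m) j)"
    unfolding monomial_eval_def using A i
    by (subst \<open>set_mset (add_mset i m) = insert i A\<close>, subst finprod_insert)
       (auto intro!: nat_pow_closed xi)
  also have "(\<Otimes>j\<in>A. x j [^] count (add_mset i m) j) = p"
    unfolding p_def using A by (intro finprod_cong') (auto intro!: nat_pow_closed xi)
  finally show ?thesis using 1 p xi[OF i] by (simp add: m_ac)
qed

lemma indexed_pset_support:
  assumes "P \<in> indexed_pset B (carrier R)"
  shows "P m \<in> carrier R" and "finite {m. P m \<noteq> \<zero>}" and "P m \<noteq> \<zero> \<Longrightarrow> set_mset m \<subseteq> B"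
proof -
  show "P m \<in> carrier R"
    using indexed_pset_in_carrier[OF _ assms] by (auto simp: carrier_coeff_def)
  have "finite {m. P m \<noteq> \<zero>} \<and> (\<forall>m. P m \<noteq> \<zero> \<longrightarrow> set_mset m \<subseteq> B)"
    using assms
  proof induction
    case (indexed_const k)
    have "{m. local.indexed_const k m \<noteq> \<zero>} \<subseteq> {{#}}" by (auto simp: indexed_const_def)
    then have "finite {m. local.indexed_const k m \<noteq> \<zero>}" by (rule finite_subset) simp
    then show ?case by (auto simp: indexed_const_def)
  next
    case (indexed_padd P Q)
    have *: "P m \<noteq> \<zero> \<or> Q m \<noteq> \<zero>" if "(P \<Oplus> Q) m \<noteq> \<zero>" for m
      using that by (auto simp: indexed_padd_def)
    then have "{m. (P \<Oplus> Q) m \<noteq> \<zero>} \<subseteq> {m. P m \<noteq> \<zero>} \<union> {m. Q m \<noteq> \<zero>}" by blast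
    then have "finite {m. (P \<Oplus> Q) m \<noteq> \<zero>}" by (rule finite_subset) (use indexed_padd in simp)
    then show ?case using * indexed_padd.IH by blast
  next
    case (indexed_pmult P i)
    have *: "m = add_mset i (m - {#i#}) \<and> P (m - {#i#}) \<noteq> \<zero>" if "(P \<Otimes> i) m \<noteq> \<zero>" for m
      using that by (auto simp: indexed_pmult_def split: if_splits)
    then have "{m. (P \<Otimes> i) m \<noteq> \<zero>} \<subseteq> add_mset i ` {m. P m \<noteq> \<zero>}" by blast
    then have "finite {m. (P \<Otimes> i) m \<noteq> \<zero>}" by (rule finite_subset) (use indexed_pmult in simp)
    moreover have "set_mset m \<subseteq> B" if "(P \<Otimes> i) m \<noteq> \<zero>" for m
    proof -
      have "set_mset (m - {#i#}) \<subseteq> B" using *[OF that] indexed_pmult.IH by blast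
      then have "set_mset (add_mset i (m - {#i#})) \<subseteq> B" using indexed_pmult.hyps by simp
      then show ?thesis using *[OF that] by metis
    qed
    ultimately show ?case by blast
  qed
  then show "finite {m. P m \<noteq> \<zero>}" "P m \<noteq> \<zero> \<Longrightarrow> set_mset m \<subseteq> B" by auto
qed

lemma indexed_poly_eval_superset:
  assumes P: "P \<in> indexed_pset B (carrier R)" and x: "x \<in> B \<rightarrow> carrier R"
    and A: "finite A" "{m. P m \<noteq> \<zero>} \<subseteq> A" "\<And>m. m \<in> A \<Longrightarrow> set_mset m \<subseteq> B"
  shows "indexed_poly_eval R P x = (\<Oplus>m\<in>A. P m \<otimes> monomial_eval R m x)"
  unfolding indexed_poly_eval_def monomial_eval_def[symmetric]
  using A indexed_pset_support(1)[OF P] monomial_eval_closed[OF x]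
  by (intro add.finprod_mono_neutral_cong_left) auto

lemma indexed_poly_eval_closed:
  assumes "P \<in> indexed_pset B (carrier R)" "x \<in> B \<rightarrow> carrier R"
  shows "indexed_poly_eval R P x \<in> carrier R"
  unfolding indexed_poly_eval_def monomial_eval_def[symmetric]
  using indexed_pset_support[OF assms(1)] monomial_eval_closed[OF assms(2)]
  by (intro finsum_closed) auto

lemma indexed_poly_eval_const:
  fixes x :: "'i \<Rightarrow> 'a"
  assumes "k \<in> carrier R"
  shows "indexed_poly_eval R (indexed_const k) x = k"
proof -
  have P: "indexed_const k \<in> indexed_pset {} (carrier R)"
    using assms by (rule indexed_pset.indexed_const)
  have "indexed_poly_eval R (indexed_const k) x =
      (\<Oplus>m\<in>{{#} :: 'i multiset}. indexed_const k m \<otimes> monomial_eval R m x)"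
    by (rule indexed_poly_eval_superset[OF P]) (auto simp: indexed_const_def)
  also have "\<dots> = k"
    using assms by (simp add: indexed_const_def monomial_eval_def)
  finally show ?thesis .
qed

lemma indexed_poly_eval_padd:
  assumes P: "P \<in> indexed_pset B (carrier R)" and Q: "Q \<in> indexed_pset B (carrier R)"
    and x: "x \<in> B \<rightarrow> carrier R"
  shows "indexed_poly_eval R (P \<Oplus> Q) x = indexed_poly_eval R P x \<oplus> indexed_poly_eval R Q x"
proof -
  define A where "A = {m. P m \<noteq> \<zero>} \<union> {m. Q m \<noteq> \<zero>}"
  have A: "finite A" "\<And>m. m \<in> A \<Longrightarrow> set_mset m \<subseteq> B"
    using indexed_pset_support(2,3)[OF P] indexed_pset_support(2,3)[OF Q] unfolding A_def by blast+
  note [simp] = monomial_eval_closed[OF x A(2)]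
  have c: "P m \<in> carrier R" "Q m \<in> carrier R" for m
    using indexed_pset_support(1) P Q by auto
  have PQ: "P \<Oplus> Q \<in> indexed_pset B (carrier R)" using P Q by (rule indexed_pset.indexed_padd)
  have "indexed_poly_eval R (P \<Oplus> Q) x = (\<Oplus>m\<in>A. (P \<Oplus> Q) m \<otimes> monomial_eval R m x)"
    by (rule indexed_poly_eval_superset[OF PQ x]) (use A in \<open>auto simp: A_def indexed_padd_def\<close>)
  also have "\<dots> = (\<Oplus>m\<in>A. P m \<otimes> monomial_eval R m x \<oplus> Q m \<otimes> monomial_eval R m x)"
    using A c by (intro finsum_cong') (auto simp: indexed_padd_def l_distr)
  also have "\<dots> = (\<Oplus>m\<in>A. P m \<otimes> monomial_eval R m x) \<oplus> (\<Oplus>m\<in>A. Q m \<otimes> monomial_eval R m x)"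
    using A c by (intro finsum_addf) (auto)
  finally show ?thesis
    using indexed_poly_eval_superset[OF P x A(1) _ A(2)] indexed_poly_eval_superset[OF Q x A(1) _ A(2)]
    by (auto simp: A_def)
qed

lemma indexed_poly_eval_pmult:
  assumes P: "P \<in> indexed_pset B (carrier R)" and i: "i \<in> B" and x: "x \<in> B \<rightarrow> carrier R"
  shows "indexed_poly_eval R (P \<Otimes> i) x = indexed_poly_eval R P x \<otimes> x i"
proof -
  define A where "A = {m. P m \<noteq> \<zero>}"
  have A: "finite A" "\<And>m. m \<in> A \<Longrightarrow> set_mset m \<subseteq> B"
    using indexed_pset_support(2,3)[OF P] unfolding A_def by blast+
  note [simp] = monomial_eval_closed[OF x A(2)]
  have c: "P m \<in> carrier R" for m using indexed_pset_support(1) P by auto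
  have xi: "x i \<in> carrier R" using x i by auto
  have Pi: "P \<Otimes> i \<in> indexed_pset B (carrier R)" using P i by (rule indexed_pset.indexed_pmult)
  have supp: "{m. (P \<Otimes> i) m \<noteq> \<zero>} \<subseteq> add_mset i ` A"
  proof
    fix m assume "m \<in> {m. (P \<Otimes> i) m \<noteq> \<zero>}"
    then have "m = add_mset i (m - {#i#})" "m - {#i#} \<in> A"
      by (auto simp: indexed_pmult_def A_def split: if_splits)
    then show "m \<in> add_mset i ` A" by blast
  qed
  have "indexed_poly_eval R (P \<Otimes> i) x = (\<Oplus>m\<in>add_mset i ` A. (P \<Otimes> i) m \<otimes> monomial_eval R m x)"
    by (rule indexed_poly_eval_superset[OF Pi x _ supp]) (use A i in \<open>fastforce+\<close>)
  also have "\<dots> = (\<Oplus>m\<in>A. (P \<Otimes> i) (add_mset i m) \<otimes> monomial_eval R (add_mset i m) x)"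
    using A c i by (intro finsum_reindex)
      (auto simp: indexed_pmult_def inj_on_def monomial_eval_add_mset[OF x A(2) i] xi)
  also have "\<dots> = (\<Oplus>m\<in>A. P m \<otimes> monomial_eval R m x \<otimes> x i)"
    using A c i xi by (intro finsum_cong')
      (auto simp: indexed_pmult_def monomial_eval_add_mset[OF x A(2) i] m_assoc)
  also have "\<dots> = (\<Oplus>m\<in>A. P m \<otimes> monomial_eval R m x) \<otimes> x i"
    using A c xi by (intro finsum_ldistr[symmetric]) auto
  finally show ?thesis
    using indexed_poly_eval_superset[OF P x A(1) _ A(2)] by (simp add: A_def)
qed

lemma polynomial_on_closed:
  "polynomial_on R B f \<Longrightarrow> x \<in> B \<rightarrow> carrier R \<Longrightarrow> f x \<in> carrier R"
  unfolding polynomial_on_def using indexed_poly_eval_closed by metis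

lemma polynomial_on_const: "k \<in> carrier R \<Longrightarrow> polynomial_on R B (\<lambda>_. k)"
  unfolding polynomial_on_def using indexed_pset.indexed_const
  by (metis indexed_poly_eval_const)

lemma polynomial_on_add:
  assumes "polynomial_on R B f" "polynomial_on R B g"
  shows "polynomial_on R B (\<lambda>x. f x \<oplus> g x)"
  using assms indexed_pset.indexed_padd unfolding polynomial_on_def
  by (smt (verit, best) indexed_poly_eval_padd)

lemma polynomial_on_mult_var:
  assumes "polynomial_on R B f" "i \<in> B"
  shows "polynomial_on R B (\<lambda>x. f x \<otimes> x i)"
  using assms indexed_pset.indexed_pmult unfolding polynomial_on_def
  by (smt (verit, best) indexed_poly_eval_pmult)

lemma polynomial_on_cong:
  assumes "polynomial_on R B f" "\<And>x. x \<in> B \<rightarrow> carrier R \<Longrightarrow> g x = f x"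
  shows "polynomial_on R B g"
  using assms unfolding polynomial_on_def by auto

text \<open>
  The rule has a congruence case because evaluating a polynomial agrees with the pointwise
  operations only at points of \<open>B \<rightarrow> carrier R\<close>.
\<close>

lemma polynomial_on_induct [consumes 1, case_names const add mult_var cong]:
  assumes "polynomial_on R B f"
    and "\<And>k. k \<in> carrier R \<Longrightarrow> Q (\<lambda>_. k)"
    and "\<And>f g. polynomial_on R B f \<Longrightarrow> polynomial_on R B g \<Longrightarrow> Q f \<Longrightarrow> Q g \<Longrightarrow> Q (\<lambda>x. f x \<oplus> g x)"
    and "\<And>f i. polynomial_on R B f \<Longrightarrow> Q f \<Longrightarrow> i \<in> B \<Longrightarrow> Q (\<lambda>x. f x \<otimes> x i)"
    and cong: "\<And>f g. Q f \<Longrightarrow> (\<And>x. x \<in> B \<rightarrow> carrier R \<Longrightarrow> g x = f x) \<Longrightarrow> Q g"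
  shows "Q f"
proof -
  obtain P where P: "P \<in> indexed_pset B (carrier R)"
    and f: "\<forall>x \<in> B \<rightarrow> carrier R. f x = indexed_poly_eval R P x"
    using assms(1) unfolding polynomial_on_def by auto
  have "polynomial_on R B (indexed_poly_eval R P) \<and> Q (indexed_poly_eval R P)"
    using P
  proof induction
    case (indexed_const k)
    then show ?case
      by (intro conjI polynomial_on_cong[OF polynomial_on_const[of k]] cong[OF assms(2)[of k]])
         (simp_all add: indexed_poly_eval_const)
  next
    case (indexed_padd P P')
    show ?case
      using cong[OF assms(3), of "indexed_poly_eval R P" "indexed_poly_eval R P'"]
        polynomial_on_cong[OF polynomial_on_add, of B "indexed_poly_eval R P" "indexed_poly_eval R P'"]
        indexed_padd by (simp add: indexed_poly_eval_padd)
  next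
    case (indexed_pmult P i)
    show ?case
      using cong[OF assms(4), of "indexed_poly_eval R P" i]
        polynomial_on_cong[OF polynomial_on_mult_var, of B "indexed_poly_eval R P" i]
        indexed_pmult by (simp add: indexed_poly_eval_pmult)
  qed
  then show ?thesis using f by (intro cong[of "indexed_poly_eval R P" f]) auto
qed

text \<open>
  The generating operations only multiply by variables, so the product is built by induction on
  the second factor, whose constant case is itself an induction on the first.
\<close>

lemma polynomial_on_mult:
  assumes f: "polynomial_on R B f" and g: "polynomial_on R B g"
  shows "polynomial_on R B (\<lambda>x. f x \<otimes> g x)"
proof -
  have scale: "polynomial_on R B (\<lambda>x. f x \<otimes> k)" if k: "k \<in> carrier R" for k
    using f
  proof (induction rule: polynomial_on_induct)
    case (const k')
    then show ?case using k by (auto intro: polynomial_on_const)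
  next
    case (add f g)
    show ?case
    proof (rule polynomial_on_cong[OF polynomial_on_add[OF add.IH]])
      fix x assume "x \<in> B \<rightarrow> carrier R"
      then have "f x \<in> carrier R" "g x \<in> carrier R"
        using add.hyps polynomial_on_closed by auto
      then show "(f x \<oplus> g x) \<otimes> k = f x \<otimes> k \<oplus> g x \<otimes> k" using k by (simp add: l_distr)
    qed
  next
    case (mult_var f i)
    show ?case
    proof (rule polynomial_on_cong[OF polynomial_on_mult_var[OF mult_var.IH mult_var.hyps(2)]])
      fix x assume "x \<in> B \<rightarrow> carrier R"
      then have "f x \<in> carrier R" "x i \<in> carrier R"
        using mult_var.hyps polynomial_on_closed by auto
      then show "f x \<otimes> x i \<otimes> k = f x \<otimes> k \<otimes> x i" using k by (simp add: m_ac)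
    qed
  next
    case (cong f g)
    show ?case by (rule polynomial_on_cong[OF cong(1)]) (use cong(2) in auto)
  qed
  show ?thesis using g
  proof (induction rule: polynomial_on_induct)
    case (const k)
    then show ?case by (rule scale)
  next
    case (add g h)
    show ?case
    proof (rule polynomial_on_cong[OF polynomial_on_add[OF add.IH]])
      fix x assume "x \<in> B \<rightarrow> carrier R"
      then have "f x \<in> carrier R" "g x \<in> carrier R" "h x \<in> carrier R"
        using add.hyps f polynomial_on_closed by auto
      then show "f x \<otimes> (g x \<oplus> h x) = f x \<otimes> g x \<oplus> f x \<otimes> h x" by (simp add: r_distr)
    qed
  next
    case (mult_var g i)
    show ?case
    proof (rule polynomial_on_cong[OF polynomial_on_mult_var[OF mult_var.IH mult_var.hyps(2)]])
      fix x assume "x \<in> B \<rightarrow> carrier R"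
      then have "f x \<in> carrier R" "g x \<in> carrier R" "x i \<in> carrier R"
        using mult_var.hyps f polynomial_on_closed by auto
      then show "f x \<otimes> (g x \<otimes> x i) = f x \<otimes> g x \<otimes> x i" by (simp add: m_assoc)
    qed
  next
    case (cong g h)
    show ?case by (rule polynomial_on_cong[OF cong(1)]) (use cong(2) in auto)
  qed
qed

lemma polynomial_on_var:
  assumes "i \<in> B" shows "polynomial_on R B (\<lambda>x. x i)"
  by (rule polynomial_on_cong[OF polynomial_on_mult_var[OF polynomial_on_const[of \<one>] assms]])
     (use assms in \<open>auto simp: Pi_iff\<close>)

lemma polynomial_on_sum:
  assumes "finite A" "\<And>a. a \<in> A \<Longrightarrow> polynomial_on R B (f a)"
  shows "polynomial_on R B (\<lambda>x. \<Oplus>a\<in>A. f a x)"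
  using assms
proof (induction A rule: finite_induct)
  case empty
  then show ?case by (auto intro: polynomial_on_const)
next
  case (insert a A)
  have closed: "f c x \<in> carrier R" if "c \<in> insert a A" "x \<in> B \<rightarrow> carrier R" for c x
    using polynomial_on_closed[OF insert.prems] that by blast
  have "polynomial_on R B (\<lambda>x. f a x \<oplus> (\<Oplus>c\<in>A. f c x))"
    using insert by (intro polynomial_on_add) auto
  then show ?case
  proof (rule polynomial_on_cong)
    fix x assume "x \<in> B \<rightarrow> carrier R"
    then show "(\<Oplus>c\<in>insert a A. f c x) = f a x \<oplus> (\<Oplus>c\<in>A. f c x)"
      using insert.hyps closed by (intro finsum_insert) auto
  qed
qed

lemma polynomial_on_specialise:
  assumes f: "polynomial_on R (insert b B) f" and t: "t \<in> carrier R"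
  shows "polynomial_on R B (\<lambda>x. f (x(b := t)))"
  using f
proof (induction rule: polynomial_on_induct)
  case (const k)
  then show ?case by (rule polynomial_on_const)
next
  case (add f g)
  show ?case by (rule polynomial_on_add[OF add.IH])
next
  case (mult_var f i)
  show ?case
  proof (cases "i = b")
    case True
    then show ?thesis
      using polynomial_on_mult[OF mult_var.IH polynomial_on_const[OF t]] by simp
  next
    case False
    then show ?thesis using polynomial_on_mult_var[OF mult_var.IH, of i] mult_var.hyps by simp
  qed
next
  case (cong f g)
  have "x(b := t) \<in> insert b B \<rightarrow> carrier R" if "x \<in> B \<rightarrow> carrier R" for x
    using that t by auto
  then show ?case using cong(2) by (intro polynomial_on_cong[OF cong(1)]) blast
qed

text \<open>
  Along a line parallel to a coordinate axis a polynomial function is a univariate polynomial, here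
  a coefficient list with the leading coefficient first; this is how the bound on the number of
  roots enters.
\<close>

lemma polynomial_on_line:
  assumes f: "polynomial_on R (insert b B) f" and p: "p \<in> B \<rightarrow> carrier R"
  shows "\<exists>l. set l \<subseteq> carrier R \<and> (\<forall>t\<in>carrier R. f (p(b := t)) = eval l t)"
  using f
proof (induction rule: polynomial_on_induct)
  case (const k)
  then show ?case by (intro exI[of _ "[k]"]) auto
next
  case (add f g)
  from add.IH obtain l l' where l: "set l \<subseteq> carrier R" "\<forall>t\<in>carrier R. f (p(b := t)) = eval l t"
    "set l' \<subseteq> carrier R" "\<forall>t\<in>carrier R. g (p(b := t)) = eval l' t" by blast
  show ?case
  proof (intro exI[of _ "poly_add l l'"] conjI ballI)
    show "set (poly_add l l') \<subseteq> carrier R" using l by (intro poly_add_in_carrier)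
    show "f (p(b := t)) \<oplus> g (p(b := t)) = eval (poly_add l l') t" if "t \<in> carrier R" for t
      using l that eval_poly_add by simp
  qed
next
  case (mult_var f i)
  from mult_var.IH obtain l
    where l: "set l \<subseteq> carrier R" "\<forall>t\<in>carrier R. f (p(b := t)) = eval l t" by blast
  show ?case
  proof (cases "i = b")
    case True
    then show ?thesis
      using l by (intro exI[of _ "l @ [\<zero>]"])
        (simp del: fun_upd_apply add: fun_upd_same eval_append_aux eval_in_carrier)
  next
    case False
    then have pi: "p i \<in> carrier R" using p mult_var.hyps by auto
    show ?thesis
    proof (intro exI[of _ "poly_mult l [p i]"] conjI ballI)
      show "set (poly_mult l [p i]) \<subseteq> carrier R" using l pi by (intro poly_mult_in_carrier) auto
      show "f (p(b := t)) \<otimes> (p(b := t)) i = eval (poly_mult l [p i]) t" if "t \<in> carrier R" for t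
        using l that pi False by (simp add: eval_poly_mult)
    qed
  qed
next
  case (cong f g)
  have "p(b := t) \<in> insert b B \<rightarrow> carrier R" if "t \<in> carrier R" for t
    using that p by auto
  then have "g (p(b := t)) = f (p(b := t))" if "t \<in> carrier R" for t
    using that cong(2) by blast
  then show ?case using cong(1) by (simp del: fun_upd_apply)
qed

lemma polynomial_on_restrict:
  assumes "polynomial_on R B f" "x \<in> B \<rightarrow> carrier R"
  shows "f (restrict x B) = f x"
  using assms(1)
proof (induction rule: polynomial_on_induct)
  case (cong f g)
  have "restrict x B \<in> B \<rightarrow> carrier R" using assms(2) by auto
  from cong(2)[OF this] cong(2)[OF assms(2)] cong(1) show ?case by metis
next
  case (add f g)
  then show ?case by metis
next
  case (mult_var f i)
  then show ?case by (metis restrict_apply')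
qed (rule refl)

end

lemma (in domain) finite_zeros_on_line:
  assumes "polynomial_on R (insert b B) f" "p \<in> B \<rightarrow> carrier R"
    and "s \<in> carrier R" "f (p(b := s)) \<noteq> \<zero>"
  shows "finite {t \<in> carrier R. f (p(b := t)) = \<zero>}"
proof -
  obtain l where l: "set l \<subseteq> carrier R" "\<forall>t\<in>carrier R. f (p(b := t)) = eval l t"
    using polynomial_on_line[OF assms(1,2)] by blast
  define q where "q = normalize l"
  have q: "\<forall>t\<in>carrier R. f (p(b := t)) = eval q t"
    using l eval_normalize by (auto simp: q_def)
  then have "q \<noteq> []" using assms(3,4) by auto
  moreover have "q \<in> carrier (poly_ring R)"
    using normalize_gives_polynomial[OF l(1)] by (simp add: q_def univ_poly_carrier)
  ultimately show ?thesis
    using finite_number_of_roots[of q] q by (auto simp: is_root_def elim: rev_finite_subset)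
qed

lemma card_of_finite_ordLess_infinite:
  assumes "finite A" "infinite B" shows "|A| <o |B|"
  using finite_ordLess_infinite[OF card_of_Well_order card_of_Well_order, of A B] assms
  by (simp add: Field_card_of)

text \<open>
  For infinite \<open>I\<close> the union has at most \<open>|I|\<close> elements; for finite \<open>I\<close> it is finite.
\<close>

lemma card_of_UN_finite_ordLess:
  assumes "infinite C" "|I| <o |C|" "\<And>i. i \<in> I \<Longrightarrow> finite (A i)"
  shows "|\<Union>i\<in>I. A i| <o |C|"
proof (cases "finite I")
  case True
  then have "finite (\<Union>i\<in>I. A i)" using assms(3) by blast
  then show ?thesis using assms(1) by (rule card_of_finite_ordLess_infinite)
next
  case False
  then have "\<forall>i\<in>I. |A i| \<le>o |I|"
    using assms(3) card_of_finite_ordLess_infinite ordLess_imp_ordLeq by blast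
  then have "|\<Union>i\<in>I. A i| \<le>o |I|"
    using False by (intro card_of_UNION_ordLeq_infinite card_of_refl[THEN ordIso_imp_ordLeq]) auto
  then show ?thesis using assms(2) by (rule ordLeq_ordLess_trans)
qed

text \<open>
  Induction on the variables. For each \<open>f\<close> freeze the new coordinate at a value \<open>t f\<close> that still
  leaves a nonzero function; the induction hypothesis gives the other coordinates. On the line
  through that point each \<open>f\<close> is nonzero at \<open>t f\<close>, hence has finitely many zeros, and these do not
  exhaust the field when all \<open>f\<close> are taken together.
\<close>

lemma (in domain) ex_common_nonzero:
  fixes F :: "(('i \<Rightarrow> 'a) \<Rightarrow> 'a) set"
  assumes "finite B" "infinite (carrier R)" "|F| <o |carrier R|"
    and "\<And>f. f \<in> F \<Longrightarrow> polynomial_on R B f"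
    and "\<And>f. f \<in> F \<Longrightarrow> \<exists>x \<in> B \<rightarrow> carrier R. f x \<noteq> \<zero>"
  shows "\<exists>x \<in> B \<rightarrow> carrier R. \<forall>f\<in>F. f x \<noteq> \<zero>"
  using assms(1,3-)
proof (induction B arbitrary: F rule: finite_induct)
  case empty
  have const: "\<exists>k. \<forall>x. f x = k" if "polynomial_on R {} f" for f :: "('i \<Rightarrow> 'a) \<Rightarrow> 'a"
    using that by (induction rule: polynomial_on_induct) auto
  have "f (\<lambda>_. \<one>) \<noteq> \<zero>" if f: "f \<in> F" for f
  proof -
    obtain k where k: "\<And>x. f x = k" using const[OF empty.prems(2)[OF f]] by blast
    obtain x where "f x \<noteq> \<zero>" using empty.prems(3)[OF f] by blast
    then show ?thesis by (simp only: k not_False_eq_True)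
  qed
  then show ?case by (intro bexI[of _ "\<lambda>_. \<one>"] ballI) auto
next
  case (insert b B)
  have "\<exists>t. t \<in> carrier R \<and> (\<exists>x \<in> B \<rightarrow> carrier R. f (x(b := t)) \<noteq> \<zero>)" if f: "f \<in> F" for f
  proof -
    obtain y where y: "y \<in> insert b B \<rightarrow> carrier R" "f y \<noteq> \<zero>"
      using insert.prems(3)[OF f] by blast
    have "y b \<in> carrier R" "y \<in> B \<rightarrow> carrier R" "f (y(b := y b)) \<noteq> \<zero>"
      using y by auto
    then show ?thesis by blast
  qed
  then have "\<forall>f\<in>F. \<exists>t. t \<in> carrier R \<and> (\<exists>x \<in> B \<rightarrow> carrier R. f (x(b := t)) \<noteq> \<zero>)"
    by (rule ballI)
  from bchoice[OF this] obtain t where t: "\<And>f. f \<in> F \<Longrightarrow> t f \<in> carrier R"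
    "\<And>f. f \<in> F \<Longrightarrow> \<exists>x \<in> B \<rightarrow> carrier R. f (x(b := t f)) \<noteq> \<zero>"
    by blast
  define r where "r = (\<lambda>f x. f (x(b := t f)))"
  have "\<exists>x \<in> B \<rightarrow> carrier R. \<forall>g\<in>r ` F. g x \<noteq> \<zero>"
  proof (rule insert.IH)
    show "|r ` F| <o |carrier R|"
      using card_of_image insert.prems(1) by (rule ordLeq_ordLess_trans)
    have "polynomial_on R B (r f)" if "f \<in> F" for f
      using polynomial_on_specialise[OF insert.prems(2)[OF that] t(1)[OF that]] unfolding r_def .
    then show "polynomial_on R B g" if "g \<in> r ` F" for g using that by blast
    have "\<exists>x \<in> B \<rightarrow> carrier R. r f x \<noteq> \<zero>" if "f \<in> F" for f
      using t(2)[OF that] unfolding r_def .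
    then show "\<exists>x \<in> B \<rightarrow> carrier R. g x \<noteq> \<zero>" if "g \<in> r ` F" for g
      using that by blast
  qed
  then obtain x where x: "x \<in> B \<rightarrow> carrier R" "\<And>f. f \<in> F \<Longrightarrow> r f x \<noteq> \<zero>" by blast
  have "|\<Union>f\<in>F. {s \<in> carrier R. f (x(b := s)) = \<zero>}| <o |carrier R|"
    using assms(2) insert.prems(1)
  proof (rule card_of_UN_finite_ordLess)
    fix f assume f: "f \<in> F"
    show "finite {s \<in> carrier R. f (x(b := s)) = \<zero>}"
      using finite_zeros_on_line[OF insert.prems(2)[OF f] x(1) t(1)[OF f] x(2)[OF f, unfolded r_def]] .
  qed
  then have "\<not> carrier R \<subseteq> (\<Union>f\<in>F. {s \<in> carrier R. f (x(b := s)) = \<zero>})"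
    using card_of_mono1 not_ordLess_ordLeq by blast
  then obtain s where s: "s \<in> carrier R" "\<forall>f\<in>F. f (x(b := s)) \<noteq> \<zero>" by blast
  have "x(b := s) \<in> insert b B \<rightarrow> carrier R" using s(1) x(1) by auto
  then show ?case using s(2) by blast
qed

section \<open>The Zariski topology of a finite-dimensional vector space\<close>

context vectorspace
begin

lemma coordinates_props:
  assumes "finite B" "basis B" "v \<in> carrier V"
  shows "coordinates K V B v \<in> B \<rightarrow>\<^sub>E carrier K" and "lincomb (coordinates K V B v) B = v"
proof -
  have "\<exists>!c. c \<in> B \<rightarrow>\<^sub>E carrier K \<and> lincomb c B = v"
    using assms basis_criterion[of B] by (simp add: basis_def)
  from theI'[OF this] show "coordinates K V B v \<in> B \<rightarrow>\<^sub>E carrier K"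
    and "lincomb (coordinates K V B v) B = v"
    unfolding coordinates_def by auto
qed

lemma coordinates_lincomb:
  assumes "finite B" "basis B" "c \<in> B \<rightarrow>\<^sub>E carrier K"
  shows "coordinates K V B (lincomb c B) = c"
proof -
  have "B \<subseteq> carrier V" using assms(2) by (simp add: basis_def)
  then have v: "lincomb c B \<in> carrier V" using assms(3) by (intro lincomb_closed) auto
  have "\<exists>!d. d \<in> B \<rightarrow>\<^sub>E carrier K \<and> lincomb d B = lincomb c B"
    using assms v basis_criterion[of B] by (simp add: basis_def)
  then show ?thesis using assms(3) coordinates_props[OF assms(1,2) v] by blast
qed

text \<open>
  The form in which Zariski closed sets are used: a point outside is separated by one polynomial
  function. Unions and intersections of such sets are then easy to treat.
\<close>

definition polynomially_separated :: "'c set \<Rightarrow> 'c set \<Rightarrow> bool" where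
  "polynomially_separated B Z \<longleftrightarrow> Z \<subseteq> carrier V \<and>
     (\<forall>v \<in> carrier V - Z. \<exists>f. polynomial_on K B f \<and>
        (\<forall>z\<in>Z. f (coordinates K V B z) = \<zero>\<^bsub>K\<^esub>) \<and> f (coordinates K V B v) \<noteq> \<zero>\<^bsub>K\<^esub>)"

lemma zariski_closed_iff:
  assumes "finite B" "basis B"
  shows "zariski_closed K V B Z \<longleftrightarrow> polynomially_separated B Z"
proof
  assume "zariski_closed K V B Z"
  then obtain S where S: "S \<subseteq> indexed_pset B (carrier K)"
    "Z = {v \<in> carrier V. \<forall>P\<in>S. indexed_poly_eval K P (coordinates K V B v) = \<zero>\<^bsub>K\<^esub>}"
    unfolding zariski_closed_def by blast
  have pol: "polynomial_on K B (indexed_poly_eval K P)" if "P \<in> S" for P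
    using that S(1) unfolding polynomial_on_def by blast
  show "polynomially_separated B Z"
    unfolding polynomially_separated_def
  proof (intro conjI ballI)
    show "Z \<subseteq> carrier V" using S(2) by blast
    fix v assume "v \<in> carrier V - Z"
    then obtain P where "P \<in> S" "indexed_poly_eval K P (coordinates K V B v) \<noteq> \<zero>\<^bsub>K\<^esub>"
      using S(2) by blast
    moreover have "\<forall>z\<in>Z. indexed_poly_eval K P (coordinates K V B z) = \<zero>\<^bsub>K\<^esub>"
      using S(2) \<open>P \<in> S\<close> by blast
    ultimately show "\<exists>f. polynomial_on K B f \<and>
        (\<forall>z\<in>Z. f (coordinates K V B z) = \<zero>\<^bsub>K\<^esub>) \<and> f (coordinates K V B v) \<noteq> \<zero>\<^bsub>K\<^esub>"
      using pol by blast
  qed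
next
  assume sep: "polynomially_separated B Z"
  \<comment> \<open>The largest possible family of equations: all polynomials that vanish on \<open>Z\<close>.\<close>
  define S where "S = {P \<in> indexed_pset B (carrier K).
    \<forall>z\<in>Z. indexed_poly_eval K P (coordinates K V B z) = \<zero>\<^bsub>K\<^esub>}"
  have "v \<in> Z" if v: "v \<in> carrier V" "\<forall>P\<in>S. indexed_poly_eval K P (coordinates K V B v) = \<zero>\<^bsub>K\<^esub>" for v
  proof (rule ccontr)
    assume "v \<notin> Z"
    then obtain f where f: "polynomial_on K B f" "\<forall>z\<in>Z. f (coordinates K V B z) = \<zero>\<^bsub>K\<^esub>"
      "f (coordinates K V B v) \<noteq> \<zero>\<^bsub>K\<^esub>"
      using sep v(1) unfolding polynomially_separated_def by blast
    from f(1) obtain P where P: "P \<in> indexed_pset B (carrier K)"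
      "\<forall>x \<in> B \<rightarrow> carrier K. f x = indexed_poly_eval K P x"
      unfolding polynomial_on_def by blast
    have c: "coordinates K V B u \<in> B \<rightarrow> carrier K" if "u \<in> carrier V" for u
      using coordinates_props(1)[OF assms that] by (auto simp: PiE_def)
    have "Z \<subseteq> carrier V" using sep unfolding polynomially_separated_def by blast
    then have "indexed_poly_eval K P (coordinates K V B z) = \<zero>\<^bsub>K\<^esub>" if "z \<in> Z" for z
      using P(2) f(2) c that by (metis subsetD)
    then have "P \<in> S" using P(1) unfolding S_def by blast
    then show False using v P(2) f(3) c[OF v(1)] by metis
  qed
  then have "Z = {v \<in> carrier V. \<forall>P\<in>S. indexed_poly_eval K P (coordinates K V B v) = \<zero>\<^bsub>K\<^esub>}"
    using sep unfolding polynomially_separated_def S_def by blast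
  moreover have "S \<subseteq> indexed_pset B (carrier K)" unfolding S_def by blast
  ultimately show "zariski_closed K V B Z" unfolding zariski_closed_def by blast
qed

text \<open>
  Multiply the two separating functions; the product is nonzero at the point because the scalars
  form a field.
\<close>

lemma polynomially_separated_Un:
  assumes "finite B" "basis B" "polynomially_separated B Y" "polynomially_separated B Z"
  shows "polynomially_separated B (Y \<union> Z)"
  unfolding polynomially_separated_def
proof (intro conjI ballI)
  show sub: "Y \<union> Z \<subseteq> carrier V" using assms unfolding polynomially_separated_def by blast
  have c: "coordinates K V B u \<in> B \<rightarrow> carrier K" if "u \<in> carrier V" for u
    using coordinates_props(1)[OF assms(1,2) that] by (auto simp: PiE_def)
  fix v assume v: "v \<in> carrier V - (Y \<union> Z)"
  obtain f where f: "polynomial_on K B f" "\<forall>z\<in>Y. f (coordinates K V B z) = \<zero>\<^bsub>K\<^esub>"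
    "f (coordinates K V B v) \<noteq> \<zero>\<^bsub>K\<^esub>"
    using assms(3) v unfolding polynomially_separated_def by blast
  obtain g where g: "polynomial_on K B g" "\<forall>z\<in>Z. g (coordinates K V B z) = \<zero>\<^bsub>K\<^esub>"
    "g (coordinates K V B v) \<noteq> \<zero>\<^bsub>K\<^esub>"
    using assms(4) v unfolding polynomially_separated_def by blast
  have fc: "f (coordinates K V B u) \<in> carrier K" "g (coordinates K V B u) \<in> carrier K"
    if "u \<in> carrier V" for u using polynomial_on_closed f(1) g(1) c[OF that] by auto
  show "\<exists>f. polynomial_on K B f \<and>
        (\<forall>z\<in>Y \<union> Z. f (coordinates K V B z) = \<zero>\<^bsub>K\<^esub>) \<and> f (coordinates K V B v) \<noteq> \<zero>\<^bsub>K\<^esub>"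
  proof (intro exI[of _ "\<lambda>x. f x \<otimes>\<^bsub>K\<^esub> g x"] conjI ballI)
    show "polynomial_on K B (\<lambda>x. f x \<otimes>\<^bsub>K\<^esub> g x)" using f(1) g(1) by (rule polynomial_on_mult)
    show "f (coordinates K V B z) \<otimes>\<^bsub>K\<^esub> g (coordinates K V B z) = \<zero>\<^bsub>K\<^esub>" if "z \<in> Y \<union> Z" for z
      using that f(2) g(2) fc[of z] sub by auto
    show "f (coordinates K V B v) \<otimes>\<^bsub>K\<^esub> g (coordinates K V B v) \<noteq> \<zero>\<^bsub>K\<^esub>"
      using f(3) g(3) fc[of v] v field.integral_iff by auto
  qed
qed

lemma polynomially_separated_Int:
  assumes "\<And>Z. Z \<in> \<Z> \<Longrightarrow> polynomially_separated B Z"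
  shows "polynomially_separated B (carrier V \<inter> \<Inter>\<Z>)"
  unfolding polynomially_separated_def
proof (intro conjI ballI)
  fix v assume "v \<in> carrier V - (carrier V \<inter> \<Inter>\<Z>)"
  then obtain Z where Z: "Z \<in> \<Z>" "v \<in> carrier V - Z" by blast
  then obtain f where "polynomial_on K B f" "\<forall>z\<in>Z. f (coordinates K V B z) = \<zero>\<^bsub>K\<^esub>"
    "f (coordinates K V B v) \<noteq> \<zero>\<^bsub>K\<^esub>"
    using assms[OF Z(1)] unfolding polynomially_separated_def by blast
  then show "\<exists>f. polynomial_on K B f \<and> (\<forall>z\<in>carrier V \<inter> \<Inter>\<Z>. f (coordinates K V B z) = \<zero>\<^bsub>K\<^esub>)
      \<and> f (coordinates K V B v) \<noteq> \<zero>\<^bsub>K\<^esub>"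
    using Z(1) by blast
qed blast

text \<open>
  The existential quantifier hides the basis chosen inside \<^const>\<open>zariski_topology\<close>; all that
  matters later is that one finite basis describes the closed sets.
\<close>

lemma closedin_zariski_topology:
  assumes "fin_dim"
  shows "topspace (zariski_topology K V) = carrier V"
    and "\<exists>B. finite B \<and> basis B \<and>
      (\<forall>Z. closedin (zariski_topology K V) Z \<longleftrightarrow> polynomially_separated B Z)"
proof -
  define B where "B = (SOME B. basis B)"
  have basis: "basis B"
    unfolding B_def using finite_basis_exists[OF assms] by (metis someI)
  have fin: "finite B"
    using li_le_dim(1)[OF assms, of B] basis by (simp add: basis_def)
  define L where "L U \<longleftrightarrow> U \<subseteq> carrier V \<and> polynomially_separated B (carrier V - U)" for U
  have "istopology L"
    unfolding istopology_def
  proof (intro conjI allI impI)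
    fix S T assume "L S" "L T"
    moreover have "carrier V - S \<inter> T = (carrier V - S) \<union> (carrier V - T)" by blast
    ultimately show "L (S \<inter> T)"
      using polynomially_separated_Un[OF fin basis] unfolding L_def by auto
  next
    fix \<U> assume U: "\<forall>U\<in>\<U>. L U"
    have "carrier V - \<Union>\<U> = carrier V \<inter> \<Inter>((\<lambda>U. carrier V - U) ` \<U>)" by blast
    moreover have "polynomially_separated B Z" if "Z \<in> (\<lambda>U. carrier V - U) ` \<U>" for Z
      using that U unfolding L_def by blast
    ultimately have "polynomially_separated B (carrier V - \<Union>\<U>)"
      using polynomially_separated_Int[of "(\<lambda>U. carrier V - U) ` \<U>" B] by presburger
    moreover have "\<Union>\<U> \<subseteq> carrier V" using U unfolding L_def by blast
    ultimately show "L (\<Union>\<U>)" unfolding L_def by (rule conjI[rotated])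
  qed
  moreover have "zariski_topology K V = topology L"
    unfolding zariski_topology_def Let_def B_def[symmetric] zariski_closed_iff[OF fin basis] L_def ..
  ultimately have op: "openin (zariski_topology K V) U \<longleftrightarrow> L U" for U by simp
  have "L (carrier V)"
    unfolding L_def polynomially_separated_def
    using polynomial_on_const[of "\<one>\<^bsub>K\<^esub>" B] by auto
  then show top: "topspace (zariski_topology K V) = carrier V"
    unfolding topspace_def op L_def by blast
  have "closedin (zariski_topology K V) Z \<longleftrightarrow> polynomially_separated B Z" for Z
  proof -
    have "carrier V - (carrier V - Z) = Z" if "Z \<subseteq> carrier V" using that by blast
    moreover have "Z \<subseteq> carrier V" if "polynomially_separated B Z"
      using that unfolding polynomially_separated_def by (rule conjunct1)
    ultimately show ?thesis
      unfolding closedin_def op top L_def by (metis Diff_subset)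
  qed
  with fin basis show "\<exists>B. finite B \<and> basis B \<and>
      (\<forall>Z. closedin (zariski_topology K V) Z \<longleftrightarrow> polynomially_separated B Z)"
    by blast
qed

text \<open>
  Each proper closed set lies in the zero set of one nonzero polynomial function, so a common
  nonzero of these functions gives the coordinates of an uncovered vector.
\<close>

lemma zariski_closed_sets_do_not_cover:
  assumes "fin_dim" "infinite (carrier K)" "|\<Z>| <o |carrier K|"
    and "\<And>Z. Z \<in> \<Z> \<Longrightarrow> closedin (zariski_topology K V) Z \<and> Z \<noteq> carrier V"
  shows "\<exists>v \<in> carrier V. v \<notin> \<Union>\<Z>"
proof -
  obtain B where B: "finite B" "basis B"
    "\<And>Z. closedin (zariski_topology K V) Z \<longleftrightarrow> polynomially_separated B Z"
    using closedin_zariski_topology(2)[OF assms(1)] by metis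
  have c: "coordinates K V B u \<in> B \<rightarrow> carrier K" if "u \<in> carrier V" for u
    using coordinates_props(1)[OF B(1,2) that] by (auto simp: PiE_def)
  have "\<exists>f. polynomial_on K B f \<and> (\<exists>x \<in> B \<rightarrow> carrier K. f x \<noteq> \<zero>\<^bsub>K\<^esub>) \<and>
      (\<forall>z\<in>Z. f (coordinates K V B z) = \<zero>\<^bsub>K\<^esub>)" if "Z \<in> \<Z>" for Z
  proof -
    have Z: "polynomially_separated B Z" "Z \<noteq> carrier V" using assms(4)[OF that] B(3) by auto
    then obtain v where v: "v \<in> carrier V - Z" unfolding polynomially_separated_def by blast
    then show ?thesis using Z(1) c[of v] unfolding polynomially_separated_def by blast
  qed
  then have "\<forall>Z\<in>\<Z>. \<exists>f. polynomial_on K B f \<and> (\<exists>x \<in> B \<rightarrow> carrier K. f x \<noteq> \<zero>\<^bsub>K\<^esub>) \<and>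
      (\<forall>z\<in>Z. f (coordinates K V B z) = \<zero>\<^bsub>K\<^esub>)" by (rule ballI)
  from bchoice[OF this] obtain f where f: "\<forall>Z\<in>\<Z>. polynomial_on K B (f Z) \<and>
      (\<exists>x \<in> B \<rightarrow> carrier K. f Z x \<noteq> \<zero>\<^bsub>K\<^esub>) \<and> (\<forall>z\<in>Z. f Z (coordinates K V B z) = \<zero>\<^bsub>K\<^esub>)" by blast
  have "\<exists>x \<in> B \<rightarrow> carrier K. \<forall>g \<in> f ` \<Z>. g x \<noteq> \<zero>\<^bsub>K\<^esub>"
  proof (rule ex_common_nonzero[OF B(1) assms(2)])
    show "|f ` \<Z>| <o |carrier K|"
      using card_of_image assms(3) by (rule ordLeq_ordLess_trans)
  qed (use f in blast)+
  then obtain x where x: "x \<in> B \<rightarrow> carrier K" "\<And>Z. Z \<in> \<Z> \<Longrightarrow> f Z x \<noteq> \<zero>\<^bsub>K\<^esub>" by blast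
  define v where "v = lincomb (restrict x B) B"
  have "restrict x B \<in> B \<rightarrow>\<^sub>E carrier K" using x(1) by auto
  then have v: "v \<in> carrier V" "coordinates K V B v = restrict x B"
    using coordinates_lincomb[OF B(1,2)] B(2) by (auto simp: v_def basis_def PiE_def)
  have "v \<notin> Z" if "Z \<in> \<Z>" for Z
  proof
    assume "v \<in> Z"
    then have "f Z (restrict x B) = \<zero>\<^bsub>K\<^esub>" using f that v(2) by force
    moreover have "f Z (restrict x B) = f Z x"
      using f that x(1) polynomial_on_restrict by blast
    ultimately show False using x(2)[OF that] by simp
  qed
  then show ?thesis using v(1) by blast
qed

text \<open>
  If each basis vector \<open>b\<close> is congruent to \<open>s b \<odot> e\<close> modulo \<open>W\<close>, then \<open>\<Sum> c b \<odot> b\<close> is congruent to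
  \<open>(\<Sum> c b \<otimes> s b) \<odot> e\<close>. So \<open>W\<close> is the zero set of the linear form with coefficients \<open>s\<close>.
\<close>

lemma closedin_zariski_hyperplane:
  assumes fd: "fin_dim" and W: "Module.submodule W K V" and e: "e \<in> carrier V" "e \<notin> W"
    and compl: "\<And>v. v \<in> carrier V \<Longrightarrow> \<exists>k \<in> carrier K. v \<ominus>\<^bsub>V\<^esub> k \<odot>\<^bsub>V\<^esub> e \<in> W"
  shows "closedin (zariski_topology K V) W"
proof -
  obtain B where B: "finite B" "basis B"
    "\<And>Z. closedin (zariski_topology K V) Z \<longleftrightarrow> polynomially_separated B Z"
    using closedin_zariski_topology(2)[OF fd] by metis
  have BV: "B \<subseteq> carrier V" using B(2) by (simp add: basis_def)
  note Wc = submoduleE[OF W]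
  have zero: "\<zero>\<^bsub>V\<^esub> \<in> W"
    using subgroup.one_closed[OF submodule.axioms(1)[OF W]] by simp
  have "\<forall>b\<in>B. \<exists>k. k \<in> carrier K \<and> b \<ominus>\<^bsub>V\<^esub> k \<odot>\<^bsub>V\<^esub> e \<in> W" using compl BV by blast
  from bchoice[OF this] obtain s
    where s: "\<And>b. b \<in> B \<Longrightarrow> s b \<in> carrier K" "\<And>b. b \<in> B \<Longrightarrow> b \<ominus>\<^bsub>V\<^esub> s b \<odot>\<^bsub>V\<^esub> e \<in> W" by blast
  define \<phi> where "\<phi> c = (\<Oplus>\<^bsub>K\<^esub>b\<in>B. c b \<otimes>\<^bsub>K\<^esub> s b)" for c
  have \<phi>: "\<phi> c \<in> carrier K" if "c \<in> B \<rightarrow> carrier K" for c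
    unfolding \<phi>_def using that s(1) by (intro module.R.finsum_closed) auto
  have diff: "lincomb c B \<ominus>\<^bsub>V\<^esub> \<phi> c \<odot>\<^bsub>V\<^esub> e \<in> W" if c: "c \<in> B \<rightarrow> carrier K" for c
  proof -
    have "lincomb c A \<ominus>\<^bsub>V\<^esub> (\<Oplus>\<^bsub>K\<^esub>b\<in>A. c b \<otimes>\<^bsub>K\<^esub> s b) \<odot>\<^bsub>V\<^esub> e \<in> W" if "finite A" "A \<subseteq> B" for A
      using that
    proof (induction A rule: finite_induct)
      case empty
      have "\<zero>\<^bsub>V\<^esub> \<ominus>\<^bsub>V\<^esub> \<zero>\<^bsub>K\<^esub> \<odot>\<^bsub>V\<^esub> e = \<zero>\<^bsub>V\<^esub>" using e(1) by (simp add: a_minus_def)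
      then show ?case using zero by (simp add: lincomb_def)
    next
      case (insert a A)
      have cl: "c a \<in> carrier K" "s a \<in> carrier K" "a \<in> carrier V"
        "c \<in> A \<rightarrow> carrier K" "A \<subseteq> carrier V" "(\<lambda>b. c b \<otimes>\<^bsub>K\<^esub> s b) \<in> A \<rightarrow> carrier K"
        "c \<in> A \<union> {a} \<rightarrow> carrier K"
        using insert.prems c s(1) BV by (auto intro!: module.R.m_closed)
      let ?S = "\<Oplus>\<^bsub>K\<^esub>b\<in>A. c b \<otimes>\<^bsub>K\<^esub> s b"
      have S: "?S \<in> carrier K" using cl(6) by (rule module.R.finsum_closed)
      have l: "lincomb c A \<in> carrier V" using cl by (intro lincomb_closed)
      have 1: "lincomb c (insert a A) = c a \<odot>\<^bsub>V\<^esub> a \<oplus>\<^bsub>V\<^esub> lincomb c A"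
        using lincomb_insert[of A c a] insert.hyps cl by simp
      have 2: "(\<Oplus>\<^bsub>K\<^esub>b\<in>insert a A. c b \<otimes>\<^bsub>K\<^esub> s b) = c a \<otimes>\<^bsub>K\<^esub> s a \<oplus>\<^bsub>K\<^esub> ?S"
        using insert.hyps cl by (intro module.R.finsum_insert) auto
      have "c a \<odot>\<^bsub>V\<^esub> (a \<ominus>\<^bsub>V\<^esub> s a \<odot>\<^bsub>V\<^esub> e) \<oplus>\<^bsub>V\<^esub> (lincomb c A \<ominus>\<^bsub>V\<^esub> ?S \<odot>\<^bsub>V\<^esub> e) \<in> W"
        using insert.IH insert.prems s(2) cl(1) Wc by auto
      also have "c a \<odot>\<^bsub>V\<^esub> (a \<ominus>\<^bsub>V\<^esub> s a \<odot>\<^bsub>V\<^esub> e) \<oplus>\<^bsub>V\<^esub> (lincomb c A \<ominus>\<^bsub>V\<^esub> ?S \<odot>\<^bsub>V\<^esub> e) =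
          (c a \<odot>\<^bsub>V\<^esub> a \<oplus>\<^bsub>V\<^esub> lincomb c A) \<ominus>\<^bsub>V\<^esub> (c a \<otimes>\<^bsub>K\<^esub> s a \<oplus>\<^bsub>K\<^esub> ?S) \<odot>\<^bsub>V\<^esub> e"
        using cl(1-3) S l e(1)
        by (simp add: a_minus_def smult_r_distr smult_l_distr smult_assoc1 smult_r_minus
            M.minus_add M.a_ac)
      finally show ?case by (simp add: 1 2)
    qed
    then show ?thesis using B(1) by (auto simp: \<phi>_def)
  qed
  have mem: "lincomb c B \<in> W \<longleftrightarrow> \<phi> c = \<zero>\<^bsub>K\<^esub>" if c: "c \<in> B \<rightarrow> carrier K" for c
  proof
    have l: "lincomb c B \<in> carrier V" using BV c by (rule lincomb_closed)
    let ?d = "lincomb c B \<ominus>\<^bsub>V\<^esub> \<phi> c \<odot>\<^bsub>V\<^esub> e"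
    have d: "?d \<in> W" "?d \<in> carrier V" using diff[OF c] Wc(1) by auto
    have eq: "lincomb c B = ?d \<oplus>\<^bsub>V\<^esub> \<phi> c \<odot>\<^bsub>V\<^esub> e"
      using l \<phi>[OF c] e(1) by (simp add: a_minus_def M.a_assoc M.l_neg)
    show "lincomb c B \<in> W" if "\<phi> c = \<zero>\<^bsub>K\<^esub>"
      using eq d that e(1) by simp
    show "\<phi> c = \<zero>\<^bsub>K\<^esub>" if lW: "lincomb c B \<in> W"
    proof (rule ccontr)
      assume nz: "\<phi> c \<noteq> \<zero>\<^bsub>K\<^esub>"
      have "\<ominus>\<^bsub>V\<^esub> ?d \<oplus>\<^bsub>V\<^esub> lincomb c B \<in> W"
        using d(1) lW Wc(3,5) by blast
      also have "\<ominus>\<^bsub>V\<^esub> ?d \<oplus>\<^bsub>V\<^esub> lincomb c B = \<phi> c \<odot>\<^bsub>V\<^esub> e"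
        using \<phi>[OF c] e(1) d(2) by (subst eq) (intro M.r_neg1, auto)
      finally have "\<phi> c \<odot>\<^bsub>V\<^esub> e \<in> W" .
      then have "inv\<^bsub>K\<^esub> \<phi> c \<odot>\<^bsub>V\<^esub> (\<phi> c \<odot>\<^bsub>V\<^esub> e) \<in> W"
        using nz \<phi>[OF c] Wc(4) by (simp add: field_Units)
      moreover have "inv\<^bsub>K\<^esub> \<phi> c \<odot>\<^bsub>V\<^esub> (\<phi> c \<odot>\<^bsub>V\<^esub> e) = e"
        using nz \<phi>[OF c] e(1) by (simp add: smult_assoc1[symmetric] field_Units)
      ultimately show False using e(2) by simp
    qed
  qed
  have "polynomially_separated B W"
    unfolding polynomially_separated_def
  proof (intro conjI ballI)
    show "W \<subseteq> carrier V" by (rule Wc(1))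
    have c: "coordinates K V B u \<in> B \<rightarrow> carrier K" "lincomb (coordinates K V B u) B = u"
      if "u \<in> carrier V" for u
      using coordinates_props[OF B(1,2) that] by (auto simp: PiE_def)
    fix v assume v: "v \<in> carrier V - W"
    have "polynomial_on K B (\<lambda>c. \<Oplus>\<^bsub>K\<^esub>b\<in>B. c b \<otimes>\<^bsub>K\<^esub> s b)"
      by (intro polynomial_on_sum polynomial_on_mult polynomial_on_var polynomial_on_const s B)
    then have "polynomial_on K B \<phi>" unfolding \<phi>_def .
    moreover have "\<phi> (coordinates K V B z) = \<zero>\<^bsub>K\<^esub>" if "z \<in> W" for z
      using mem[of "coordinates K V B z"] c[of z] that Wc(1) by auto
    moreover have "\<phi> (coordinates K V B v) \<noteq> \<zero>\<^bsub>K\<^esub>"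
      using mem[of "coordinates K V B v"] c[of v] v by auto
    ultimately show "\<exists>f. polynomial_on K B f \<and>
        (\<forall>z\<in>W. f (coordinates K V B z) = \<zero>\<^bsub>K\<^esub>) \<and> f (coordinates K V B v) \<noteq> \<zero>\<^bsub>K\<^esub>" by blast
  qed
  then show ?thesis using B(3) by blast
qed

end

section \<open>Submodules, quotients and fibres\<close>

context module
begin

lemma submodule_diff:
  assumes "submodule R N M" "x \<in> N" "y \<in> N"
  shows "x \<ominus>\<^bsub>M\<^esub> y \<in> N"
proof -
  interpret N: submodule R N M by fact
  have y: "y \<in> carrier M" using assms(3) N.subset by blast
  have "\<ominus>\<^bsub>M\<^esub> y = (\<ominus> \<one>) \<odot>\<^bsub>M\<^esub> y" using y by (simp add: smult_l_minus)
  then have "\<ominus>\<^bsub>M\<^esub> y \<in> N" using assms(3) by simp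
  then show ?thesis using assms(2) by (simp add: a_minus_def)
qed

text \<open>
  The unqualified \<open>submodule\<close> is \<^locale>\<open>LinearCombinations.submodule\<close>, which does not mention
  additive inverses: multiplication by the scalar minus one provides them.
\<close>

lemma submodule_iff: "Module.submodule N R M \<longleftrightarrow> submodule R N M"
proof
  assume N: "Module.submodule N R M"
  have "\<zero>\<^bsub>M\<^esub> \<in> N"
    using subgroup.one_closed[OF Module.submodule.axioms(1)[OF N]] by simp
  then show "submodule R N M"
    using submoduleE(1,4,5)[OF N] module_axioms by (intro submodule.intro) auto
next
  assume N: "submodule R N M"
  then interpret N: submodule R N M .
  show "Module.submodule N R M"
  proof (rule submoduleI)
    show "\<ominus>\<^bsub>M\<^esub> a \<in> N" if "a \<in> N" for a
      using submodule_diff[OF N N.zero_closed that] subsetD[OF N.subset that] by (simp add: a_minus_def)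
  qed (use N.subset in auto)
qed

lemma submodule_cosets:
  assumes N: "submodule R N M"
  shows "abelian_subgroup N M"
proof -
  have "Module.submodule N R M" using N submodule_iff by blast
  then have "additive_subgroup N M"
    by (intro additive_subgroupI Module.submodule.axioms(1))
  then show ?thesis by (intro abelian_subgroupI3) (auto intro: M.abelian_group_axioms)
qed

lemma coset_eq_iff:
  assumes N: "submodule R N M" and x: "x \<in> carrier M" and y: "y \<in> carrier M"
  shows "N +>\<^bsub>M\<^esub> x = N +>\<^bsub>M\<^esub> y \<longleftrightarrow> x \<ominus>\<^bsub>M\<^esub> y \<in> N"
proof -
  interpret Q: abelian_subgroup N M by (rule submodule_cosets[OF N])
  have "N +>\<^bsub>M\<^esub> x = N +>\<^bsub>M\<^esub> y \<longleftrightarrow> x \<in> N +>\<^bsub>M\<^esub> y"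
    using M.a_repr_independence[OF _ y Q.a_subgroup] Q.a_rcos_self[OF x] by metis
  also have "\<dots> \<longleftrightarrow> x \<oplus>\<^bsub>M\<^esub> \<ominus>\<^bsub>M\<^esub> y \<in> N"
    by (rule Q.a_rcos_module[OF y x])
  finally show ?thesis by (simp add: a_minus_def)
qed

lemma coset_mem:
  assumes N: "submodule R N M" and x: "x \<in> carrier M" and z: "z \<in> N +>\<^bsub>M\<^esub> x"
  shows "z \<in> carrier M" "N +>\<^bsub>M\<^esub> z = N +>\<^bsub>M\<^esub> x"
proof -
  interpret Q: abelian_subgroup N M by (rule submodule_cosets[OF N])
  show "z \<in> carrier M" using Q.a_elemrcos_carrier[OF x z] .
  show "N +>\<^bsub>M\<^esub> z = N +>\<^bsub>M\<^esub> x"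
    using M.a_repr_independence[OF z x Q.a_subgroup] by simp
qed

lemma coset_add:
  assumes "submodule R N M" "x \<in> carrier M" "y \<in> carrier M"
  shows "set_add M (N +>\<^bsub>M\<^esub> x) (N +>\<^bsub>M\<^esub> y) = N +>\<^bsub>M\<^esub> (x \<oplus>\<^bsub>M\<^esub> y)"
  using abelian_subgroup.a_rcos_sum[OF submodule_cosets] assms by blast

lemma coset_self:
  assumes "submodule R N M" "x \<in> carrier M"
  shows "x \<in> N +>\<^bsub>M\<^esub> x"
  using abelian_subgroup.a_rcos_self[OF submodule_cosets] assms by blast

lemma coset_zero:
  assumes "submodule R N M"
  shows "N +>\<^bsub>M\<^esub> \<zero>\<^bsub>M\<^esub> = N"
  using submodule.subset[OF assms] by (rule M.a_coset_add_zero)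

subsection \<open>The submodule \<open>IM\<close>\<close>

lemma ideal_smult_submodule:
  assumes "I \<subseteq> carrier R"
  shows "submodule R (ideal_smult R M I) M"
  unfolding ideal_smult_def using assms by (intro span_is_submodule) auto

lemma ideal_smult_mem:
  assumes "I \<subseteq> carrier R" "a \<in> I" "x \<in> carrier M"
  shows "a \<odot>\<^bsub>M\<^esub> x \<in> ideal_smult R M I"
proof -
  have "{a \<odot>\<^bsub>M\<^esub> x |a x. a \<in> I \<and> x \<in> carrier M} \<subseteq> carrier M" using assms(1) by auto
  from in_own_span[OF this] show ?thesis unfolding ideal_smult_def using assms by blast
qed

lemma ideal_smult_subset:
  assumes "submodule R N M" "\<And>a x. a \<in> I \<Longrightarrow> x \<in> carrier M \<Longrightarrow> a \<odot>\<^bsub>M\<^esub> x \<in> N"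
  shows "ideal_smult R M I \<subseteq> N"
  unfolding ideal_smult_def using assms by (intro span_is_subset) auto

text \<open>
  The union over all representatives in the definition of \<^const>\<open>fibre\<close> collapses to one coset:
  if \<open>b - a \<in> I\<close> and \<open>y - x \<in> IM\<close>, then \<open>by - ax = b(y - x) + (b - a)x\<close> is in \<open>IM\<close>.
\<close>

lemma coset_smult:
  assumes I: "ideal I R" and a: "a \<in> carrier R" and x: "x \<in> carrier M"
  shows "(\<Union>b\<in>I +> a. \<Union>y\<in>ideal_smult R M I +>\<^bsub>M\<^esub> x. ideal_smult R M I +>\<^bsub>M\<^esub> (b \<odot>\<^bsub>M\<^esub> y)) =
    ideal_smult R M I +>\<^bsub>M\<^esub> (a \<odot>\<^bsub>M\<^esub> x)"
proof -
  interpret I: ideal I R by fact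
  let ?N = "ideal_smult R M I"
  have N: "submodule R ?N M" by (rule ideal_smult_submodule[OF I.a_subset])
  interpret N: submodule R ?N M by fact
  have *: "?N +>\<^bsub>M\<^esub> (b \<odot>\<^bsub>M\<^esub> y) = ?N +>\<^bsub>M\<^esub> (a \<odot>\<^bsub>M\<^esub> x)"
    if b: "b \<in> I +> a" and y: "y \<in> ?N +>\<^bsub>M\<^esub> x" for b y
  proof -
    have b': "b \<in> carrier R" "b \<ominus> a \<in> I"
      using I.a_elemrcos_carrier[OF a b] I.a_rcos_module_imp[OF a b] by (auto simp: a_minus_def)
    have y': "y \<in> carrier M" "y \<ominus>\<^bsub>M\<^esub> x \<in> ?N"
      using coset_mem[OF N x y] coset_eq_iff[OF N _ x] by auto
    have "b \<odot>\<^bsub>M\<^esub> (y \<ominus>\<^bsub>M\<^esub> x) \<oplus>\<^bsub>M\<^esub> (b \<ominus> a) \<odot>\<^bsub>M\<^esub> x \<in> ?N"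
      using b' y' ideal_smult_mem[OF I.a_subset b'(2) x] by auto
    also have "b \<odot>\<^bsub>M\<^esub> (y \<ominus>\<^bsub>M\<^esub> x) \<oplus>\<^bsub>M\<^esub> (b \<ominus> a) \<odot>\<^bsub>M\<^esub> x = b \<odot>\<^bsub>M\<^esub> y \<ominus>\<^bsub>M\<^esub> a \<odot>\<^bsub>M\<^esub> x"
      using a x b'(1) y'(1)
      by (simp add: a_minus_def smult_r_distr smult_l_distr smult_l_minus smult_r_minus M.a_assoc M.r_neg1)
    finally show ?thesis using coset_eq_iff[OF N] a x b'(1) y'(1) by simp
  qed
  have "a \<in> I +> a" "x \<in> ?N +>\<^bsub>M\<^esub> x"
    using I.a_rcos_self[OF a] coset_self[OF N x] by auto
  then show ?thesis using * by blast
qed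

subsection \<open>Fibres are finite-dimensional vector spaces\<close>

lemma fibre_simps:
  assumes I: "ideal I R"
  shows "carrier (fibre R M I) = (\<lambda>x. ideal_smult R M I +>\<^bsub>M\<^esub> x) ` carrier M"
    and "\<And>x y. x \<in> carrier M \<Longrightarrow> y \<in> carrier M \<Longrightarrow>
      (ideal_smult R M I +>\<^bsub>M\<^esub> x) \<oplus>\<^bsub>fibre R M I\<^esub> (ideal_smult R M I +>\<^bsub>M\<^esub> y) =
      ideal_smult R M I +>\<^bsub>M\<^esub> (x \<oplus>\<^bsub>M\<^esub> y)"
    and "\<And>a x. a \<in> carrier R \<Longrightarrow> x \<in> carrier M \<Longrightarrow>
      (I +> a) \<odot>\<^bsub>fibre R M I\<^esub> (ideal_smult R M I +>\<^bsub>M\<^esub> x) = ideal_smult R M I +>\<^bsub>M\<^esub> (a \<odot>\<^bsub>M\<^esub> x)"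
    and "\<zero>\<^bsub>fibre R M I\<^esub> = ideal_smult R M I +>\<^bsub>M\<^esub> \<zero>\<^bsub>M\<^esub>"
proof -
  interpret I: ideal I R by fact
  have N: "submodule R (ideal_smult R M I) M" by (rule ideal_smult_submodule[OF I.a_subset])
  show "carrier (fibre R M I) = (\<lambda>x. ideal_smult R M I +>\<^bsub>M\<^esub> x) ` carrier M"
    by (auto simp: fibre_def A_RCOSETS_def')
  show "(ideal_smult R M I +>\<^bsub>M\<^esub> x) \<oplus>\<^bsub>fibre R M I\<^esub> (ideal_smult R M I +>\<^bsub>M\<^esub> y) =
      ideal_smult R M I +>\<^bsub>M\<^esub> (x \<oplus>\<^bsub>M\<^esub> y)" if "x \<in> carrier M" "y \<in> carrier M" for x y
    using coset_add[OF N that] by (simp add: fibre_def)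
  show "(I +> a) \<odot>\<^bsub>fibre R M I\<^esub> (ideal_smult R M I +>\<^bsub>M\<^esub> x) = ideal_smult R M I +>\<^bsub>M\<^esub> (a \<odot>\<^bsub>M\<^esub> x)"
    if "a \<in> carrier R" "x \<in> carrier M" for a x
    using coset_smult[OF I that] by (simp add: fibre_def)
  show "\<zero>\<^bsub>fibre R M I\<^esub> = ideal_smult R M I +>\<^bsub>M\<^esub> \<zero>\<^bsub>M\<^esub>"
    using coset_zero[OF N] by (simp add: fibre_def)
qed

lemma Quot_carrier: "carrier (R Quot I) = (\<lambda>a. I +> a) ` carrier R"
  by (auto simp: FactRing_def A_RCOSETS_def')

lemma Quot_simps:
  assumes "ideal I R"
  shows "\<And>a b. a \<in> carrier R \<Longrightarrow> b \<in> carrier R \<Longrightarrow> (I +> a) \<oplus>\<^bsub>R Quot I\<^esub> (I +> b) = I +> (a \<oplus> b)"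
    and "\<And>a b. a \<in> carrier R \<Longrightarrow> b \<in> carrier R \<Longrightarrow> (I +> a) \<otimes>\<^bsub>R Quot I\<^esub> (I +> b) = I +> (a \<otimes> b)"
    and "\<one>\<^bsub>R Quot I\<^esub> = I +> \<one>" and "\<zero>\<^bsub>R Quot I\<^esub> = I +> \<zero>"
proof -
  interpret I: ideal I R by fact
  show "(I +> a) \<oplus>\<^bsub>R Quot I\<^esub> (I +> b) = I +> (a \<oplus> b)"
    and "(I +> a) \<otimes>\<^bsub>R Quot I\<^esub> (I +> b) = I +> (a \<otimes> b)"
    if "a \<in> carrier R" "b \<in> carrier R" for a b
    using I.a_rcos_sum[OF that] I.rcoset_mult_add[OF that] by (auto simp: FactRing_def)
  show "\<one>\<^bsub>R Quot I\<^esub> = I +> \<one>" "\<zero>\<^bsub>R Quot I\<^esub> = I +> \<zero>"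
    using R.a_coset_add_zero[OF I.a_subset] by (auto simp: FactRing_def)
qed

lemma fibre_vectorspace:
  assumes m: "maximalideal \<mm> R"
  shows "vectorspace (R Quot \<mm>) (fibre R M \<mm>)"
proof -
  interpret m: maximalideal \<mm> R by fact
  have I: "ideal \<mm> R" by (rule m.is_ideal)
  note simps = fibre_simps[OF I] Quot_carrier Quot_simps[OF I]
  have neg: "\<exists>w\<in>carrier M. ideal_smult R M \<mm> +>\<^bsub>M\<^esub> (v \<oplus>\<^bsub>M\<^esub> w) = ideal_smult R M \<mm> +>\<^bsub>M\<^esub> \<zero>\<^bsub>M\<^esub>"
    if "v \<in> carrier M" for v
    using that by (intro bexI[of _ "\<ominus>\<^bsub>M\<^esub> v"]) (simp_all add: M.r_neg)
  show ?thesis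
    by (rule vs_criteria[OF m.quotient_is_field[OF R.is_cring]])
       (auto simp: simps neg M.a_assoc M.a_comm M.a_lcomm smult_l_distr smult_r_distr smult_assoc1)
qed

text \<open>
  The elements of \<open>M\<close> whose coset lies in the span of the cosets of the generators form a submodule
  that contains the generators, hence all of \<open>M\<close>.
\<close>

lemma fibre_fin_dim:
  assumes m: "maximalideal \<mm> R" and fg: "module_fg R M"
  shows "vectorspace.fin_dim (R Quot \<mm>) (fibre R M \<mm>)"
proof -
  interpret m: maximalideal \<mm> R by fact
  interpret V: vectorspace "R Quot \<mm>" "fibre R M \<mm>" by (rule fibre_vectorspace[OF m])
  note simps = fibre_simps[OF m.is_ideal]
  let ?\<pi> = "\<lambda>x. ideal_smult R M \<mm> +>\<^bsub>M\<^esub> x"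
  obtain A where A: "finite A" "A \<subseteq> carrier M" "span A = carrier M"
    using fg unfolding module_fg_def by blast
  have sub: "?\<pi> ` A \<subseteq> carrier (fibre R M \<mm>)" using A(2) simps(1) by auto
  interpret S: submodule "R Quot \<mm>" "V.span (?\<pi> ` A)" "fibre R M \<mm>"
    by (rule V.span_is_submodule[OF sub])
  let ?N = "{x \<in> carrier M. ?\<pi> x \<in> V.span (?\<pi> ` A)}"
  have "submodule R ?N M"
  proof (rule submodule.intro)
    show "v \<oplus>\<^bsub>M\<^esub> w \<in> ?N" if "v \<in> ?N" "w \<in> ?N" for v w
    proof -
      have "?\<pi> v \<oplus>\<^bsub>fibre R M \<mm>\<^esub> ?\<pi> w \<in> V.span (?\<pi> ` A)" using that by (intro S.m_closed) auto
      then show ?thesis using that by (simp add: simps(2))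
    qed
    show "\<zero>\<^bsub>M\<^esub> \<in> ?N" using S.zero_closed simps(4) by auto
    show "c \<odot>\<^bsub>M\<^esub> v \<in> ?N" if "c \<in> carrier R" "v \<in> ?N" for c v
    proof -
      have "(\<mm> +> c) \<odot>\<^bsub>fibre R M \<mm>\<^esub> ?\<pi> v \<in> V.span (?\<pi> ` A)"
        using that by (intro S.smult_closed) (auto simp: Quot_carrier)
      then show ?thesis using that by (simp add: simps(3))
    qed
  qed (auto intro: module_axioms)
  moreover have "A \<subseteq> ?N" using A(2) V.in_own_span[OF sub] by auto
  ultimately have "carrier M \<subseteq> ?N" using span_is_subset[of A ?N] A(3) by auto
  then have "carrier (fibre R M \<mm>) \<subseteq> V.span (?\<pi> ` A)" using simps(1) by auto
  then have "V.span (?\<pi> ` A) = carrier (fibre R M \<mm>)" using S.subset by auto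
  then show ?thesis unfolding V.fin_dim_def using A(1) sub by blast
qed

section \<open>Maximal submodules\<close>

lemma a_inv_zero: "\<ominus>\<^bsub>M\<^esub> \<zero>\<^bsub>M\<^esub> = \<zero>\<^bsub>M\<^esub>"
  by (metis M.r_neg M.l_zero M.zero_closed M.a_inv_closed)

definition maximal_submodule :: "'c set \<Rightarrow> bool" where
  "maximal_submodule N \<longleftrightarrow> submodule R N M \<and> N \<noteq> carrier M \<and>
     (\<forall>L. submodule R L M \<longrightarrow> N \<subseteq> L \<longrightarrow> L = N \<or> L = carrier M)"

text \<open>
  Zorn's lemma. The union of a chain of proper submodules is proper, since otherwise a single
  member of the chain would already contain the finitely many generators.
\<close>

lemma ex_maximal_submodule:
  assumes fg: "module_fg R M" and N: "submodule R N M" "N \<noteq> carrier M"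
  shows "\<exists>L. maximal_submodule L \<and> N \<subseteq> L"
proof -
  obtain A where A: "finite A" "A \<subseteq> carrier M" "span A = carrier M"
    using fg unfolding module_fg_def by blast
  define \<A> where "\<A> = {L. submodule R L M \<and> N \<subseteq> L \<and> L \<noteq> carrier M}"
  have "N \<in> \<A>" using N by (simp add: \<A>_def)
  moreover have "\<Union>\<C> \<in> \<A>" if ne: "\<C> \<noteq> {}" and ch: "subset.chain \<A> \<C>" for \<C>
  proof -
    have sub: "submodule R L M" "N \<subseteq> L" "L \<noteq> carrier M" if "L \<in> \<C>" for L
      using ch that unfolding subset_chain_def \<A>_def by auto
    have tot: "L \<subseteq> L' \<or> L' \<subseteq> L" if "L \<in> \<C>" "L' \<in> \<C>" for L L'
      using ch that unfolding subset_chain_def by blast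
    have "submodule R (\<Union>\<C>) M"
    proof (rule submodule.intro)
      show "\<Union>\<C> \<subseteq> carrier M" using sub(1) submodule.subset by blast
      show "v \<oplus>\<^bsub>M\<^esub> w \<in> \<Union>\<C>" if vw: "v \<in> \<Union>\<C>" "w \<in> \<Union>\<C>" for v w
      proof -
        obtain L L' where L: "L \<in> \<C>" "v \<in> L" "L' \<in> \<C>" "w \<in> L'" using vw by blast
        then obtain L'' where "L'' \<in> \<C>" "v \<in> L''" "w \<in> L''" using tot[OF L(1,3)] by blast
        then show ?thesis using submodule.m_closed[OF sub(1)] by blast
      qed
      show "\<zero>\<^bsub>M\<^esub> \<in> \<Union>\<C>" using ne submodule.zero_closed[OF sub(1)] by blast
      show "c \<odot>\<^bsub>M\<^esub> v \<in> \<Union>\<C>" if "c \<in> carrier R" "v \<in> \<Union>\<C>" for c v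
        using that submodule.smult_closed[OF sub(1)] by blast
    qed (rule module_axioms)
    moreover have "N \<subseteq> \<Union>\<C>" using ne sub(2) by blast
    moreover have "\<Union>\<C> \<noteq> carrier M"
    proof
      assume "\<Union>\<C> = carrier M"
      then have "A \<subseteq> \<Union>\<C>" using A(2) by simp
      then obtain L where L: "L \<in> \<C>" "A \<subseteq> L"
        using finite_subset_Union_chain[OF A(1) _ ne ch] by metis
      have "carrier M \<subseteq> L" using span_is_subset[OF L(2) sub(1)[OF L(1)]] A(3) by simp
      then show False using sub(3)[OF L(1)] submodule.subset[OF sub(1)[OF L(1)]] by blast
    qed
    ultimately show ?thesis by (simp add: \<A>_def)
  qed
  ultimately obtain L where L: "L \<in> \<A>" "\<forall>L'\<in>\<A>. L \<subseteq> L' \<longrightarrow> L' = L"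
    using subset_Zorn_nonempty[of \<A>] by (metis empty_iff)
  have "L' = L \<or> L' = carrier M" if "submodule R L' M" "L \<subseteq> L'" for L'
    using L that unfolding \<A>_def by blast
  moreover have "submodule R L M" "N \<subseteq> L" "L \<noteq> carrier M" using L(1) by (auto simp: \<A>_def)
  ultimately have "maximal_submodule L \<and> N \<subseteq> L" unfolding maximal_submodule_def by simp
  then show ?thesis by (rule exI)
qed

text \<open>
  By maximality, \<open>N\<close> and \<open>x\<close> generate \<open>M\<close>: the quotient \<open>M/N\<close> is simple.
\<close>

lemma maximal_submodule_line:
  assumes N: "maximal_submodule N" and x: "x \<in> carrier M" "x \<notin> N" and y: "y \<in> carrier M"
  shows "\<exists>r \<in> carrier R. y \<ominus>\<^bsub>M\<^esub> r \<odot>\<^bsub>M\<^esub> x \<in> N"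
proof -
  have sub: "submodule R N M" using N unfolding maximal_submodule_def by blast
  interpret N: submodule R N M by fact
  let ?L = "{y \<in> carrier M. \<exists>r \<in> carrier R. y \<ominus>\<^bsub>M\<^esub> r \<odot>\<^bsub>M\<^esub> x \<in> N}"
  have "submodule R ?L M"
  proof (rule submodule.intro)
    show "?L \<subseteq> carrier M" by blast
    show "v \<oplus>\<^bsub>M\<^esub> w \<in> ?L" if vw: "v \<in> ?L" "w \<in> ?L" for v w
    proof -
      obtain r s where r: "r \<in> carrier R" "v \<ominus>\<^bsub>M\<^esub> r \<odot>\<^bsub>M\<^esub> x \<in> N"
        and s: "s \<in> carrier R" "w \<ominus>\<^bsub>M\<^esub> s \<odot>\<^bsub>M\<^esub> x \<in> N" using vw by blast
      have "(v \<ominus>\<^bsub>M\<^esub> r \<odot>\<^bsub>M\<^esub> x) \<oplus>\<^bsub>M\<^esub> (w \<ominus>\<^bsub>M\<^esub> s \<odot>\<^bsub>M\<^esub> x) \<in> N" using r s by simp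
      also have "(v \<ominus>\<^bsub>M\<^esub> r \<odot>\<^bsub>M\<^esub> x) \<oplus>\<^bsub>M\<^esub> (w \<ominus>\<^bsub>M\<^esub> s \<odot>\<^bsub>M\<^esub> x) = (v \<oplus>\<^bsub>M\<^esub> w) \<ominus>\<^bsub>M\<^esub> (r \<oplus> s) \<odot>\<^bsub>M\<^esub> x"
        using vw r(1) s(1) x(1) by (simp add: a_minus_def smult_l_distr M.minus_add M.a_ac)
      finally show ?thesis using vw r(1) s(1) by blast
    qed
    show "\<zero>\<^bsub>M\<^esub> \<in> ?L"
      using x(1) by (auto intro!: bexI[of _ \<zero>] simp: a_minus_def a_inv_zero)
    show "c \<odot>\<^bsub>M\<^esub> v \<in> ?L" if c: "c \<in> carrier R" and v: "v \<in> ?L" for c v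
    proof -
      obtain r where r: "r \<in> carrier R" "v \<ominus>\<^bsub>M\<^esub> r \<odot>\<^bsub>M\<^esub> x \<in> N" using v by blast
      have "c \<odot>\<^bsub>M\<^esub> (v \<ominus>\<^bsub>M\<^esub> r \<odot>\<^bsub>M\<^esub> x) \<in> N" using r c by simp
      also have "c \<odot>\<^bsub>M\<^esub> (v \<ominus>\<^bsub>M\<^esub> r \<odot>\<^bsub>M\<^esub> x) = c \<odot>\<^bsub>M\<^esub> v \<ominus>\<^bsub>M\<^esub> (c \<otimes> r) \<odot>\<^bsub>M\<^esub> x"
        using v c r(1) x(1) by (simp add: a_minus_def smult_r_distr smult_r_minus smult_assoc1)
      finally show ?thesis using v c r(1) by blast
    qed
  qed (rule module_axioms)
  moreover have "N \<subseteq> ?L"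
  proof
    fix n assume n: "n \<in> N"
    then have "n \<in> carrier M" using N.subset by blast
    then show "n \<in> ?L" using n x(1) by (auto intro!: bexI[of _ \<zero>] simp: a_minus_def a_inv_zero)
  qed
  moreover have "x \<in> ?L"
    using x(1) by (auto intro!: bexI[of _ \<one>] simp: a_minus_def M.r_neg)
  ultimately have "?L = carrier M"
    using N x(2) unfolding maximal_submodule_def by blast
  then show ?thesis using y by blast
qed

text \<open>
  The ideal is the annihilator of the simple module \<open>M/N\<close>, obtained here as the set of scalars that
  send one fixed element \<open>x\<close> outside \<open>N\<close> into \<open>N\<close>.
\<close>

lemma maximal_submodule_ideal:
  assumes N: "maximal_submodule N"
  shows "\<exists>\<mm>. maximalideal \<mm> R \<and> ideal_smult R M \<mm> \<subseteq> N"
proof -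
  have sub: "submodule R N M" using N unfolding maximal_submodule_def by blast
  interpret N: submodule R N M by fact
  obtain x where x: "x \<in> carrier M" "x \<notin> N"
    using N N.subset unfolding maximal_submodule_def by blast
  define \<mm> where "\<mm> = {r \<in> carrier R. r \<odot>\<^bsub>M\<^esub> x \<in> N}"
  have I: "ideal \<mm> R"
  proof (rule idealI[OF R.ring_axioms])
    show "subgroup \<mm> (add_monoid R)"
    proof (rule R.add.subgroupI)
      show "\<mm> \<noteq> {}" using x(1) by (auto simp: \<mm>_def intro!: exI[of _ \<zero>])
      show "\<ominus> a \<in> \<mm>" if "a \<in> \<mm>" for a
        using that submodule_diff[OF sub N.zero_closed, of "a \<odot>\<^bsub>M\<^esub> x"] x(1)
        by (simp add: \<mm>_def smult_l_minus a_minus_def)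
    qed (auto simp: \<mm>_def smult_l_distr x(1))
    show "r \<otimes> a \<in> \<mm>" if "a \<in> \<mm>" "r \<in> carrier R" for a r
      using that x(1) by (simp add: \<mm>_def smult_assoc1)
    then show "a \<otimes> r \<in> \<mm>" if "a \<in> \<mm>" "r \<in> carrier R" for a r
      using that by (simp add: R.m_comm \<mm>_def)
  qed
  have "maximalideal \<mm> R"
  proof (rule maximalidealI[OF I])
    have "\<one> \<notin> \<mm>" using x by (simp add: \<mm>_def)
    then show "carrier R \<noteq> \<mm>" using R.one_closed by blast
    fix J assume J: "ideal J R" "\<mm> \<subseteq> J" "J \<subseteq> carrier R"
    interpret J: ideal J R by (rule J(1))
    show "J = \<mm> \<or> J = carrier R"
    proof (rule disjCI)
      assume "J \<noteq> carrier R"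
      show "J = \<mm>"
      proof (rule ccontr)
        assume "J \<noteq> \<mm>"
        then obtain j where j: "j \<in> J" "j \<notin> \<mm>" using J(2) by blast
        then have jR: "j \<in> carrier R" using J(3) by blast
        then have "j \<odot>\<^bsub>M\<^esub> x \<notin> N" using j(2) by (simp add: \<mm>_def)
        then obtain r where r: "r \<in> carrier R" "x \<ominus>\<^bsub>M\<^esub> r \<odot>\<^bsub>M\<^esub> (j \<odot>\<^bsub>M\<^esub> x) \<in> N"
          using maximal_submodule_line[OF N, of "j \<odot>\<^bsub>M\<^esub> x" x] x(1) jR by auto
        have "x \<ominus>\<^bsub>M\<^esub> r \<odot>\<^bsub>M\<^esub> (j \<odot>\<^bsub>M\<^esub> x) = (\<one> \<ominus> r \<otimes> j) \<odot>\<^bsub>M\<^esub> x"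
          using r(1) jR x(1) by (simp add: a_minus_def smult_l_distr smult_l_minus smult_assoc1)
        then have "\<one> \<ominus> r \<otimes> j \<in> J" using r jR J(2) by (auto simp: \<mm>_def)
        moreover have "r \<otimes> j \<in> J" using r(1) j(1) by (rule J.I_l_closed[rotated])
        ultimately have "(\<one> \<ominus> r \<otimes> j) \<oplus> r \<otimes> j \<in> J" by simp
        also have "(\<one> \<ominus> r \<otimes> j) \<oplus> r \<otimes> j = \<one>"
          using r(1) jR by (simp add: a_minus_def R.a_assoc R.l_neg)
        finally show False using J.one_imp_carrier \<open>J \<noteq> carrier R\<close> by blast
      qed
    qed
  qed
  moreover have "ideal_smult R M \<mm> \<subseteq> N"
  proof (rule ideal_smult_subset[OF sub])
    fix a y assume a: "a \<in> \<mm>" and y: "y \<in> carrier M"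
    obtain r where r: "r \<in> carrier R" "y \<ominus>\<^bsub>M\<^esub> r \<odot>\<^bsub>M\<^esub> x \<in> N"
      using maximal_submodule_line[OF N x y] by blast
    have aR: "a \<in> carrier R" "a \<odot>\<^bsub>M\<^esub> x \<in> N" using a by (auto simp: \<mm>_def)
    have "a \<odot>\<^bsub>M\<^esub> (y \<ominus>\<^bsub>M\<^esub> r \<odot>\<^bsub>M\<^esub> x) \<oplus>\<^bsub>M\<^esub> r \<odot>\<^bsub>M\<^esub> (a \<odot>\<^bsub>M\<^esub> x) \<in> N" using aR r by simp
    also have "r \<odot>\<^bsub>M\<^esub> (a \<odot>\<^bsub>M\<^esub> x) = a \<odot>\<^bsub>M\<^esub> (r \<odot>\<^bsub>M\<^esub> x)"
      using aR(1) r(1) x(1) by (simp add: smult_assoc1[symmetric] R.m_comm)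
    also have "a \<odot>\<^bsub>M\<^esub> (y \<ominus>\<^bsub>M\<^esub> r \<odot>\<^bsub>M\<^esub> x) \<oplus>\<^bsub>M\<^esub> a \<odot>\<^bsub>M\<^esub> (r \<odot>\<^bsub>M\<^esub> x) = a \<odot>\<^bsub>M\<^esub> y"
      using aR(1) r(1) x(1) y
      by (simp add: smult_r_distr[symmetric] a_minus_def M.a_assoc M.l_neg)
    finally show "a \<odot>\<^bsub>M\<^esub> y \<in> N" .
  qed
  ultimately show ?thesis by blast
qed

section \<open>The Chinese remainder theorem for modules\<close>

lemma ex_comaximal:
  assumes m: "maximalideal \<mm> R" and n: "maximalideal \<nn> R" and ne: "\<mm> \<noteq> \<nn>"
  shows "\<exists>u \<in> \<nn>. \<one> \<ominus> u \<in> \<mm>"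
proof -
  interpret m: maximalideal \<mm> R by fact
  interpret n: maximalideal \<nn> R by fact
  have "ideal (\<mm> <+>\<^bsub>R\<^esub> \<nn>) R" by (rule R.add_ideals[OF m.is_ideal n.is_ideal])
  moreover have sub: "\<mm> \<subseteq> \<mm> <+>\<^bsub>R\<^esub> \<nn>" "\<nn> \<subseteq> \<mm> <+>\<^bsub>R\<^esub> \<nn>"
  proof -
    have "a \<oplus> \<zero> \<in> \<mm> <+>\<^bsub>R\<^esub> \<nn>" if "a \<in> \<mm>" for a
      using that n.zero_closed unfolding set_add_def' by blast
    then show "\<mm> \<subseteq> \<mm> <+>\<^bsub>R\<^esub> \<nn>" using m.a_Hcarr by auto
    have "\<zero> \<oplus> a \<in> \<mm> <+>\<^bsub>R\<^esub> \<nn>" if "a \<in> \<nn>" for a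
      using that m.zero_closed unfolding set_add_def' by blast
    then show "\<nn> \<subseteq> \<mm> <+>\<^bsub>R\<^esub> \<nn>" using n.a_Hcarr by auto
  qed
  moreover have "\<mm> <+>\<^bsub>R\<^esub> \<nn> \<subseteq> carrier R"
    by (rule R.set_add_closed[OF m.a_subset n.a_subset])
  ultimately have "\<mm> <+>\<^bsub>R\<^esub> \<nn> = \<mm> \<or> \<mm> <+>\<^bsub>R\<^esub> \<nn> = carrier R" by (intro m.I_maximal)
  then have "\<mm> <+>\<^bsub>R\<^esub> \<nn> = carrier R"
  proof
    assume "\<mm> <+>\<^bsub>R\<^esub> \<nn> = \<mm>"
    then have "\<nn> \<subseteq> \<mm>" using sub(2) by simp
    then have "\<mm> = \<nn> \<or> \<mm> = carrier R" using n.I_maximal[OF m.is_ideal] m.a_subset by blast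
    then show ?thesis using ne m.I_notcarr by blast
  qed
  then have "\<one> \<in> \<mm> <+>\<^bsub>R\<^esub> \<nn>" by simp
  then obtain a u where a: "a \<in> \<mm>" "u \<in> \<nn>" "\<one> = a \<oplus> u" unfolding set_add_def' by blast
  then have "\<one> \<ominus> u = a"
    using m.a_Hcarr n.a_Hcarr by (simp add: a_minus_def R.a_assoc R.r_neg)
  then show ?thesis using a by blast
qed

text \<open>
  Take the product of the elements given by \<open>ex_comaximal\<close>, one for each ideal in \<open>S\<close>.
\<close>

lemma ex_separating_element:
  assumes "finite S" "maximalideal \<mm> R" "\<And>\<nn>. \<nn> \<in> S \<Longrightarrow> maximalideal \<nn> R" "\<mm> \<notin> S"
  shows "\<exists>e \<in> carrier R. \<one> \<ominus> e \<in> \<mm> \<and> (\<forall>\<nn>\<in>S. e \<in> \<nn>)"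
  using assms(1,3,4)
proof (induction S rule: finite_induct)
  case empty
  interpret m: maximalideal \<mm> R by fact
  show ?case using m.zero_closed by (intro bexI[of _ \<one>]) (auto simp: a_minus_def R.r_neg)
next
  case (insert \<nn> S)
  interpret m: maximalideal \<mm> R by fact
  interpret n: maximalideal \<nn> R using insert.prems by simp
  obtain e where e: "e \<in> carrier R" "\<one> \<ominus> e \<in> \<mm>" "\<forall>\<nn>\<in>S. e \<in> \<nn>"
    using insert.IH insert.prems by blast
  obtain u where u: "u \<in> \<nn>" "\<one> \<ominus> u \<in> \<mm>"
    using ex_comaximal[OF assms(2) n.is_maximalideal] insert.prems(2) by blast
  have uR: "u \<in> carrier R" using u(1) n.a_Hcarr by blast
  have "(\<one> \<ominus> e) \<oplus> e \<otimes> (\<one> \<ominus> u) \<in> \<mm>"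
    using e u(2) m.I_l_closed by (intro m.a_closed) auto
  also have "(\<one> \<ominus> e) \<oplus> e \<otimes> (\<one> \<ominus> u) = \<one> \<ominus> e \<otimes> u"
    using e(1) uR by (simp add: a_minus_def R.r_distr R.r_minus R.a_assoc R.r_neg1)
  finally have "\<one> \<ominus> e \<otimes> u \<in> \<mm>" .
  moreover have "e \<otimes> u \<in> \<nn>'" if "\<nn>' \<in> insert \<nn> S" for \<nn>'
  proof -
    interpret n': maximalideal \<nn>' R using insert.prems(1) that by blast
    show ?thesis
    proof (cases "\<nn>' = \<nn>")
      case True
      then show ?thesis using u(1) e(1) n.I_l_closed by simp
    next
      case False
      then have "e \<in> \<nn>'" using e(3) that by blast
      then show ?thesis using uR n'.I_r_closed by simp
    qed
  qed
  ultimately show ?case using e(1) uR by blast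
qed

text \<open>
  When \<open>\<mm>\<close> is added, correct the solution \<open>x\<close> for the other ideals to \<open>x + e(y\<^sub>\<mm> - x)\<close>, where \<open>e\<close> is
  one modulo \<open>\<mm>\<close> and lies in all the others.
\<close>

lemma chinese_remainder_fibres:
  assumes "finite S" "\<And>\<mm>. \<mm> \<in> S \<Longrightarrow> maximalideal \<mm> R" "\<And>\<mm>. \<mm> \<in> S \<Longrightarrow> y \<mm> \<in> carrier M"
  shows "\<exists>x \<in> carrier M. \<forall>\<mm>\<in>S. x \<ominus>\<^bsub>M\<^esub> y \<mm> \<in> ideal_smult R M \<mm>"
  using assms
proof (induction S rule: finite_induct)
  case empty
  then show ?case by blast
next
  case (insert \<mm> S)
  obtain x where x: "x \<in> carrier M" "\<And>\<nn>. \<nn> \<in> S \<Longrightarrow> x \<ominus>\<^bsub>M\<^esub> y \<nn> \<in> ideal_smult R M \<nn>"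
    using insert by blast
  have "\<exists>e \<in> carrier R. \<one> \<ominus> e \<in> \<mm> \<and> (\<forall>\<nn>\<in>S. e \<in> \<nn>)"
    using insert.hyps insert.prems(1) by (intro ex_separating_element) auto
  then obtain e where e: "e \<in> carrier R" "\<one> \<ominus> e \<in> \<mm>" "\<And>\<nn>. \<nn> \<in> S \<Longrightarrow> e \<in> \<nn>" by blast
  have y: "y \<nn> \<in> carrier M" if "\<nn> \<in> insert \<mm> S" for \<nn>
    using insert.prems(2) that by blast
  have sub: "\<nn> \<subseteq> carrier R" if "\<nn> \<in> insert \<mm> S" for \<nn>
    using ideal.Icarr[OF maximalideal.axioms(1)[OF insert.prems(1)[OF that]]] by blast
  let ?x = "x \<oplus>\<^bsub>M\<^esub> e \<odot>\<^bsub>M\<^esub> (y \<mm> \<ominus>\<^bsub>M\<^esub> x)"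
  have "?x \<ominus>\<^bsub>M\<^esub> y \<nn> \<in> ideal_smult R M \<nn>" if n: "\<nn> \<in> insert \<mm> S" for \<nn>
  proof (cases "\<nn> = \<mm>")
    case True
    have "(\<one> \<ominus> e) \<odot>\<^bsub>M\<^esub> (x \<ominus>\<^bsub>M\<^esub> y \<mm>) \<in> ideal_smult R M \<mm>"
      using e(2) x(1) y[of \<mm>] sub[of \<mm>] by (intro ideal_smult_mem) auto
    also have "(\<one> \<ominus> e) \<odot>\<^bsub>M\<^esub> (x \<ominus>\<^bsub>M\<^esub> y \<mm>) = ?x \<ominus>\<^bsub>M\<^esub> y \<mm>"
      using e(1) x(1) y[of \<mm>]
      by (simp add: a_minus_def smult_r_distr smult_l_distr smult_l_minus smult_r_minus M.minus_add M.a_ac)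
    finally show ?thesis using True by simp
  next
    case False
    then have nS: "\<nn> \<in> S" using n by blast
    interpret N: submodule R "ideal_smult R M \<nn>" M by (rule ideal_smult_submodule[OF sub[OF n]])
    have "(x \<ominus>\<^bsub>M\<^esub> y \<nn>) \<oplus>\<^bsub>M\<^esub> e \<odot>\<^bsub>M\<^esub> (y \<mm> \<ominus>\<^bsub>M\<^esub> x) \<in> ideal_smult R M \<nn>"
      using x y[of \<mm>] nS e(3) sub[OF n] by (intro N.m_closed ideal_smult_mem) auto
    also have "(x \<ominus>\<^bsub>M\<^esub> y \<nn>) \<oplus>\<^bsub>M\<^esub> e \<odot>\<^bsub>M\<^esub> (y \<mm> \<ominus>\<^bsub>M\<^esub> x) = ?x \<ominus>\<^bsub>M\<^esub> y \<nn>"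
      using e(1) x(1) y[OF n] y[of \<mm>] by (simp add: a_minus_def M.a_ac)
    finally show ?thesis .
  qed
  moreover have "?x \<in> carrier M" using x(1) e(1) y[of \<mm>] by simp
  ultimately show ?case by blast
qed

end

section \<open>Fibres of small and of large dimension\<close>

context module
begin

text \<open>
  A nonzero vector of a space of dimension at most one is a basis.
\<close>

lemma fibre_line_if_dim_less_2:
  assumes m: "maximalideal \<mm> R" and fg: "module_fg R M"
    and dim: "vectorspace.dim (R Quot \<mm>) (fibre R M \<mm>) < 2"
    and x: "x \<in> carrier M" "x \<notin> ideal_smult R M \<mm>" and y: "y \<in> carrier M"
  shows "\<exists>r \<in> carrier R. y \<ominus>\<^bsub>M\<^esub> r \<odot>\<^bsub>M\<^esub> x \<in> ideal_smult R M \<mm>"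
proof -
  interpret m: maximalideal \<mm> R by fact
  let ?K = "R Quot \<mm>" and ?V = "fibre R M \<mm>"
  let ?\<pi> = "\<lambda>x. ideal_smult R M \<mm> +>\<^bsub>M\<^esub> x"
  interpret V: vectorspace ?K ?V by (rule fibre_vectorspace[OF m])
  have N: "submodule R (ideal_smult R M \<mm>) M" by (rule ideal_smult_submodule[OF m.a_subset])
  note simps = fibre_simps[OF m.is_ideal]
  have \<pi>: "?\<pi> z \<in> carrier ?V" if "z \<in> carrier M" for z using that simps(1) by simp
  have nz: "?\<pi> x \<noteq> \<zero>\<^bsub>?V\<^esub>"
    using x coset_eq_iff[OF N x(1) M.zero_closed] by (simp add: simps(4) a_minus_def a_inv_zero)
  have lc: "V.lincomb a {?\<pi> x} = a (?\<pi> x) \<odot>\<^bsub>?V\<^esub> ?\<pi> x" if "a \<in> {?\<pi> x} \<rightarrow> carrier ?K" for a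
    unfolding V.lincomb_def using that \<pi>[OF x(1)] by (simp add: Pi_iff)
  have "V.lin_indpt {?\<pi> x}"
  proof (rule V.finite_lin_indpt2)
    fix a assume a: "a \<in> {?\<pi> x} \<rightarrow> carrier ?K" and z: "V.lincomb a {?\<pi> x} = \<zero>\<^bsub>?V\<^esub>"
    show "\<forall>v\<in>{?\<pi> x}. a v = \<zero>\<^bsub>?K\<^esub>"
    proof (rule ccontr)
      assume "\<not> (\<forall>v\<in>{?\<pi> x}. a v = \<zero>\<^bsub>?K\<^esub>)"
      then have a0: "a (?\<pi> x) \<noteq> \<zero>\<^bsub>?K\<^esub>" by simp
      then have "?\<pi> x = inv\<^bsub>?K\<^esub> a (?\<pi> x) \<odot>\<^bsub>?V\<^esub> \<zero>\<^bsub>?V\<^esub>"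
        using V.mult_inverse[of "a (?\<pi> x)" "?\<pi> x" "\<zero>\<^bsub>?V\<^esub>"] a z lc[OF a] \<pi>[OF x(1)] by auto
      moreover have "inv\<^bsub>?K\<^esub> a (?\<pi> x) \<in> carrier ?K"
        using a a0 by (simp add: V.field_Units Pi_iff)
      ultimately show False using nz by simp
    qed
  qed (use \<pi>[OF x(1)] in auto)
  then have "V.basis {?\<pi> x}"
    using fibre_fin_dim[OF m fg] dim \<pi>[OF x(1)] by (intro V.dim_li_is_basis) auto
  then have "?\<pi> y \<in> V.span {?\<pi> x}" using \<pi>[OF y] by (simp add: V.basis_def)
  then obtain a where a: "a \<in> {?\<pi> x} \<rightarrow> carrier ?K" "V.lincomb a {?\<pi> x} = ?\<pi> y"
    using V.finite_in_span[of "{?\<pi> x}" "?\<pi> y"] \<pi>[OF x(1)] by auto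
  then obtain r where r: "r \<in> carrier R" "a (?\<pi> x) = \<mm> +> r" by (auto simp: Quot_carrier)
  have "?\<pi> y = ?\<pi> (r \<odot>\<^bsub>M\<^esub> x)"
    using a(2) lc[OF a(1)] r x(1) by (simp add: simps(3))
  then have "y \<ominus>\<^bsub>M\<^esub> r \<odot>\<^bsub>M\<^esub> x \<in> ideal_smult R M \<mm>"
    using coset_eq_iff[OF N y] r(1) x(1) by simp
  then show ?thesis using r(1) by blast
qed

text \<open>
  The linear forms on the fibre at \<open>\<mm>\<close>, pulled back to \<open>M\<close>.
\<close>

definition residue_functional :: "'a set \<Rightarrow> ('c \<Rightarrow> 'a set) \<Rightarrow> bool" where
  "residue_functional \<mm> \<phi> \<longleftrightarrow> \<phi> \<in> carrier M \<rightarrow> carrier (R Quot \<mm>) \<and>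
     (\<forall>x\<in>carrier M. \<forall>y\<in>carrier M. \<phi> (x \<oplus>\<^bsub>M\<^esub> y) = \<phi> x \<oplus>\<^bsub>R Quot \<mm>\<^esub> \<phi> y) \<and>
     (\<forall>r\<in>carrier R. \<forall>x\<in>carrier M. \<phi> (r \<odot>\<^bsub>M\<^esub> x) = (\<mm> +> r) \<otimes>\<^bsub>R Quot \<mm>\<^esub> \<phi> x)"

text \<open>
  Take two of the coordinate functions of a basis of the fibre.
\<close>

lemma two_residue_functionals_if_dim_ge_2:
  assumes m: "maximalideal \<mm> R" and fg: "module_fg R M"
    and dim: "vectorspace.dim (R Quot \<mm>) (fibre R M \<mm>) \<ge> 2"
  shows "\<exists>\<phi> \<psi> x y. residue_functional \<mm> \<phi> \<and> residue_functional \<mm> \<psi> \<and> x \<in> carrier M \<and> y \<in> carrier M \<and>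
    \<phi> x = \<one>\<^bsub>R Quot \<mm>\<^esub> \<and> \<phi> y = \<zero>\<^bsub>R Quot \<mm>\<^esub> \<and> \<psi> y = \<one>\<^bsub>R Quot \<mm>\<^esub>"
proof -
  interpret m: maximalideal \<mm> R by fact
  let ?K = "R Quot \<mm>" and ?V = "fibre R M \<mm>"
  let ?\<pi> = "\<lambda>x. ideal_smult R M \<mm> +>\<^bsub>M\<^esub> x"
  interpret V: vectorspace ?K ?V by (rule fibre_vectorspace[OF m])
  note simps = fibre_simps[OF m.is_ideal]
  have \<pi>: "?\<pi> z \<in> carrier ?V" if "z \<in> carrier M" for z using that simps(1) by simp
  obtain B where B: "finite B" "V.basis B"
    using V.finite_basis_exists[OF fibre_fin_dim[OF m fg]] by blast
  have BV: "B \<subseteq> carrier ?V" using B(2) by (simp add: V.basis_def)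
  have "2 \<le> card B" using dim V.dim_basis[OF B] by simp
  then obtain b b' where b: "b \<in> B" "b' \<in> B" "b \<noteq> b'"
    by (metis card_le_Suc0_iff_eq[OF B(1)] not_less_eq_eq numeral_2_eq_2)
  let ?c = "\<lambda>x. coordinates ?K ?V B (?\<pi> x)"
  have c: "?c z \<in> B \<rightarrow>\<^sub>E carrier ?K" "V.lincomb (?c z) B = ?\<pi> z" if "z \<in> carrier M" for z
    using V.coordinates_props[OF B \<pi>[OF that]] by auto
  have c': "?c z \<in> B \<rightarrow> carrier ?K" if "z \<in> carrier M" for z
    using c(1)[OF that] by (simp add: PiE_def)
  have c_eq: "?c z d = a d" if "d \<in> B" "z \<in> carrier M" "a \<in> B \<rightarrow> carrier ?K" "V.lincomb a B = ?\<pi> z" for z a d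
  proof -
    have "V.lincomb (restrict a B) B = V.lincomb a B"
      using that(3) BV by (intro V.lincomb_cong) auto
    moreover have "restrict a B \<in> B \<rightarrow>\<^sub>E carrier ?K" using that(3) by auto
    ultimately have "?c z = restrict a B" using V.coordinates_lincomb[OF B] that(4) by metis
    then show ?thesis using that(1) by simp
  qed
  have fn: "residue_functional \<mm> (\<lambda>x. ?c x d)" if d: "d \<in> B" for d
    unfolding residue_functional_def
  proof (intro conjI ballI funcsetI)
    show "?c x d \<in> carrier ?K" if "x \<in> carrier M" for x using c'[OF that] d by auto
    show "?c (x \<oplus>\<^bsub>M\<^esub> y) d = ?c x d \<oplus>\<^bsub>?K\<^esub> ?c y d" if xy: "x \<in> carrier M" "y \<in> carrier M" for x y
    proof (rule c_eq[OF d])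
      show "V.lincomb (\<lambda>e. ?c x e \<oplus>\<^bsub>?K\<^esub> ?c y e) B = ?\<pi> (x \<oplus>\<^bsub>M\<^esub> y)"
        using V.lincomb_sum[OF B(1) BV c'[OF xy(1)] c'[OF xy(2)]] c(2) xy simps(2) by simp
      show "(\<lambda>e. ?c x e \<oplus>\<^bsub>?K\<^esub> ?c y e) \<in> B \<rightarrow> carrier ?K"
        using c'[OF xy(1)] c'[OF xy(2)] by (auto intro!: V.module.R.a_closed)
    qed (use xy in simp)
    show "?c (r \<odot>\<^bsub>M\<^esub> x) d = (\<mm> +> r) \<otimes>\<^bsub>?K\<^esub> ?c x d" if rx: "r \<in> carrier R" "x \<in> carrier M" for r x
    proof (rule c_eq[OF d])
      have r: "\<mm> +> r \<in> carrier ?K" using rx(1) by (auto simp: Quot_carrier)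
      show "V.lincomb (\<lambda>e. (\<mm> +> r) \<otimes>\<^bsub>?K\<^esub> ?c x e) B = ?\<pi> (r \<odot>\<^bsub>M\<^esub> x)"
        using V.lincomb_smult[OF BV c'[OF rx(2)] r] c(2) rx simps(3) by simp
      show "(\<lambda>e. (\<mm> +> r) \<otimes>\<^bsub>?K\<^esub> ?c x e) \<in> B \<rightarrow> carrier ?K"
        using c'[OF rx(2)] r by (auto intro!: V.module.R.m_closed)
    qed (use rx in simp)
  qed
  have unit: "\<exists>x \<in> carrier M. ?c x d = \<one>\<^bsub>?K\<^esub> \<and> (\<forall>e\<in>B - {d}. ?c x e = \<zero>\<^bsub>?K\<^esub>)" if d: "d \<in> B" for d
  proof -
    let ?a = "\<lambda>e. if e = d then \<one>\<^bsub>?K\<^esub> else \<zero>\<^bsub>?K\<^esub>"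
    have a: "?a \<in> B \<rightarrow> carrier ?K" by auto
    then have "V.lincomb ?a B \<in> carrier ?V" using BV by (intro V.lincomb_closed)
    then obtain x where x: "x \<in> carrier M" "V.lincomb ?a B = ?\<pi> x" unfolding simps(1) by blast
    then show ?thesis using c_eq[OF _ x(1) a x(2)] d by (intro bexI[of _ x]) auto
  qed
  obtain x where "x \<in> carrier M" "?c x b = \<one>\<^bsub>?K\<^esub>" using unit[OF b(1)] by blast
  moreover obtain y where "y \<in> carrier M" "?c y b' = \<one>\<^bsub>?K\<^esub>" "?c y b = \<zero>\<^bsub>?K\<^esub>"
    using unit[OF b(2)] b(1,3) by blast
  ultimately show ?thesis using fn[OF b(1)] fn[OF b(2)] by blast
qed

lemma residue_functional_zero:
  assumes m: "maximalideal \<mm> R" and \<phi>: "residue_functional \<mm> \<phi>"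
  shows "\<phi> \<zero>\<^bsub>M\<^esub> = \<zero>\<^bsub>R Quot \<mm>\<^esub>"
proof -
  interpret m: maximalideal \<mm> R by fact
  interpret K: field "R Quot \<mm>" by (rule m.quotient_is_field[OF R.is_cring])
  have "\<phi> (\<zero> \<odot>\<^bsub>M\<^esub> \<zero>\<^bsub>M\<^esub>) = (\<mm> +> \<zero>) \<otimes>\<^bsub>R Quot \<mm>\<^esub> \<phi> \<zero>\<^bsub>M\<^esub>"
    using \<phi> unfolding residue_functional_def by blast
  moreover have "\<phi> \<zero>\<^bsub>M\<^esub> \<in> carrier (R Quot \<mm>)" using \<phi> unfolding residue_functional_def by auto
  ultimately show ?thesis unfolding Quot_simps(4)[OF m.is_ideal, symmetric] by simp
qed

text \<open>
  The pair \<open>(\<phi>, \<psi>)\<close> maps \<open>M\<close> to the plane over the residue field. The preimages of the lines through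
  the origin are proper submodules that cover \<open>M\<close>, and there is one line for each slope \<open>k\<close>
  besides the line \<open>\<phi> = 0\<close>.
\<close>

lemma submodule_cover_of_residue_cardinality:
  assumes m: "maximalideal \<mm> R" and fg: "module_fg R M"
    and dim: "vectorspace.dim (R Quot \<mm>) (fibre R M \<mm>) \<ge> 2"
    and inf: "infinite (carrier (R Quot \<mm>))"
  shows "\<exists>\<C> \<in> submodule_covers R M. |\<C>| \<le>o |carrier (R Quot \<mm>)|"
proof -
  let ?K = "R Quot \<mm>"
  interpret m: maximalideal \<mm> R by fact
  interpret K: field ?K by (rule m.quotient_is_field[OF R.is_cring])
  obtain \<phi> \<psi> x y where \<phi>: "residue_functional \<mm> \<phi>" and \<psi>: "residue_functional \<mm> \<psi>"
    and xy: "x \<in> carrier M" "y \<in> carrier M" "\<phi> x = \<one>\<^bsub>?K\<^esub>" "\<phi> y = \<zero>\<^bsub>?K\<^esub>" "\<psi> y = \<one>\<^bsub>?K\<^esub>"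
    using two_residue_functionals_if_dim_ge_2[OF m fg dim] by blast
  have \<phi>s: "\<phi> z \<in> carrier ?K" "\<psi> z \<in> carrier ?K" if "z \<in> carrier M" for z
    using \<phi> \<psi> that unfolding residue_functional_def by auto
  have add: "\<phi> (v \<oplus>\<^bsub>M\<^esub> w) = \<phi> v \<oplus>\<^bsub>?K\<^esub> \<phi> w" "\<psi> (v \<oplus>\<^bsub>M\<^esub> w) = \<psi> v \<oplus>\<^bsub>?K\<^esub> \<psi> w"
    if "v \<in> carrier M" "w \<in> carrier M" for v w
    using \<phi> \<psi> that unfolding residue_functional_def by auto
  have smult: "\<phi> (r \<odot>\<^bsub>M\<^esub> v) = (\<mm> +> r) \<otimes>\<^bsub>?K\<^esub> \<phi> v" "\<psi> (r \<odot>\<^bsub>M\<^esub> v) = (\<mm> +> r) \<otimes>\<^bsub>?K\<^esub> \<psi> v"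
    if "r \<in> carrier R" "v \<in> carrier M" for r v
    using \<phi> \<psi> that unfolding residue_functional_def by auto
  have rc: "\<mm> +> r \<in> carrier ?K" if "r \<in> carrier R" for r using that by (auto simp: Quot_carrier)
  have zero: "\<phi> \<zero>\<^bsub>M\<^esub> = \<zero>\<^bsub>?K\<^esub>" "\<psi> \<zero>\<^bsub>M\<^esub> = \<zero>\<^bsub>?K\<^esub>"
    using residue_functional_zero[OF m] \<phi> \<psi> by auto
  define L where "L k = {z \<in> carrier M. \<psi> z = k \<otimes>\<^bsub>?K\<^esub> \<phi> z}" for k
  define L' where "L' = {z \<in> carrier M. \<phi> z = \<zero>\<^bsub>?K\<^esub>}"
  have L: "submodule R (L k) M" if k: "k \<in> carrier ?K" for k
  proof (rule submodule.intro)
    show "v \<oplus>\<^bsub>M\<^esub> w \<in> L k" if "v \<in> L k" "w \<in> L k" for v w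
      using that k by (simp add: L_def add \<phi>s K.r_distr)
    show "c \<odot>\<^bsub>M\<^esub> v \<in> L k" if "c \<in> carrier R" "v \<in> L k" for c v
      using that k by (simp add: L_def smult \<phi>s rc K.m_lcomm)
  qed (use zero k in \<open>auto simp: L_def intro: module_axioms\<close>)
  have L'_sub: "submodule R L' M"
    by (rule submodule.intro) (use zero in \<open>auto simp: L'_def add smult rc intro: module_axioms\<close>)
  have "y \<notin> L k" if "k \<in> carrier ?K" for k using xy that by (simp add: L_def)
  moreover have "x \<notin> L'" using xy by (simp add: L'_def)
  moreover have "\<Union>(L ` carrier ?K) \<union> L' = carrier M"
  proof
    show "carrier M \<subseteq> \<Union>(L ` carrier ?K) \<union> L'"
    proof
      fix z assume z: "z \<in> carrier M"
      show "z \<in> \<Union>(L ` carrier ?K) \<union> L'"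
      proof (cases "\<phi> z = \<zero>\<^bsub>?K\<^esub>")
        case True
        then show ?thesis using z by (simp add: L'_def)
      next
        case False
        then have i: "inv\<^bsub>?K\<^esub> \<phi> z \<in> carrier ?K" "inv\<^bsub>?K\<^esub> \<phi> z \<otimes>\<^bsub>?K\<^esub> \<phi> z = \<one>\<^bsub>?K\<^esub>"
          using \<phi>s(1)[OF z] by (simp_all add: K.field_Units)
        then have "\<psi> z = (\<psi> z \<otimes>\<^bsub>?K\<^esub> inv\<^bsub>?K\<^esub> \<phi> z) \<otimes>\<^bsub>?K\<^esub> \<phi> z"
          using \<phi>s[OF z] by (simp add: K.m_assoc)
        moreover have "\<psi> z \<otimes>\<^bsub>?K\<^esub> inv\<^bsub>?K\<^esub> \<phi> z \<in> carrier ?K" using \<phi>s[OF z] i by simp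
        ultimately show ?thesis using z unfolding L_def by blast
      qed
    qed
  qed (auto simp: L_def L'_def)
  ultimately have "insert L' (L ` carrier ?K) \<in> submodule_covers R M"
    unfolding submodule_covers_def submodule_iff using L L'_sub xy(1,2) by auto
  moreover have "|insert L' (L ` carrier ?K)| \<le>o |carrier ?K|"
  proof -
    have "|{L'}| \<le>o |carrier ?K|"
      using inf by (intro ordLess_imp_ordLeq card_of_finite_ordLess_infinite) auto
    then have "|{L'} \<union> L ` carrier ?K| \<le>o |carrier ?K|"
      using inf by (intro card_of_Un_ordLeq_infinite_Field)
        (auto simp: Field_card_of intro: card_of_card_order_on card_of_image)
    then show ?thesis by simp
  qed
  ultimately show ?thesis by blast
qed

section \<open>Finite dual Goldie dimension\<close>

text \<open>
  Unlike \<^const>\<open>fibre\<close>, this is a module over \<open>R\<close> itself: surjections onto products in the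
  definition of the dual Goldie dimension are \<open>R\<close>-linear.
\<close>

definition quotient_module :: "'c set \<Rightarrow> ('a, 'c set) module" where
  "quotient_module N =
     \<lparr>carrier = a_rcosets\<^bsub>M\<^esub> N, monoid.mult = undefined, one = undefined,
      zero = N, add = set_add M, smult = (\<lambda>a Y. \<Union>x\<in>Y. N +>\<^bsub>M\<^esub> (a \<odot>\<^bsub>M\<^esub> x))\<rparr>"

lemma quotient_module_simps:
  assumes N: "submodule R N M"
  shows "carrier (quotient_module N) = (\<lambda>x. N +>\<^bsub>M\<^esub> x) ` carrier M"
    and "\<And>x y. x \<in> carrier M \<Longrightarrow> y \<in> carrier M \<Longrightarrow>
      (N +>\<^bsub>M\<^esub> x) \<oplus>\<^bsub>quotient_module N\<^esub> (N +>\<^bsub>M\<^esub> y) = N +>\<^bsub>M\<^esub> (x \<oplus>\<^bsub>M\<^esub> y)"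
    and "\<And>a x. a \<in> carrier R \<Longrightarrow> x \<in> carrier M \<Longrightarrow>
      a \<odot>\<^bsub>quotient_module N\<^esub> (N +>\<^bsub>M\<^esub> x) = N +>\<^bsub>M\<^esub> (a \<odot>\<^bsub>M\<^esub> x)"
    and "\<zero>\<^bsub>quotient_module N\<^esub> = N +>\<^bsub>M\<^esub> \<zero>\<^bsub>M\<^esub>"
proof -
  show "carrier (quotient_module N) = (\<lambda>x. N +>\<^bsub>M\<^esub> x) ` carrier M"
    by (auto simp: quotient_module_def A_RCOSETS_def')
  show "(N +>\<^bsub>M\<^esub> x) \<oplus>\<^bsub>quotient_module N\<^esub> (N +>\<^bsub>M\<^esub> y) = N +>\<^bsub>M\<^esub> (x \<oplus>\<^bsub>M\<^esub> y)"
    if "x \<in> carrier M" "y \<in> carrier M" for x y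
    using coset_add[OF N that] by (simp add: quotient_module_def)
  show "\<zero>\<^bsub>quotient_module N\<^esub> = N +>\<^bsub>M\<^esub> \<zero>\<^bsub>M\<^esub>"
    using coset_zero[OF N] by (simp add: quotient_module_def)
  show "a \<odot>\<^bsub>quotient_module N\<^esub> (N +>\<^bsub>M\<^esub> x) = N +>\<^bsub>M\<^esub> (a \<odot>\<^bsub>M\<^esub> x)"
    if a: "a \<in> carrier R" and x: "x \<in> carrier M" for a x
  proof -
    have "N +>\<^bsub>M\<^esub> (a \<odot>\<^bsub>M\<^esub> y) = N +>\<^bsub>M\<^esub> (a \<odot>\<^bsub>M\<^esub> x)" if y: "y \<in> N +>\<^bsub>M\<^esub> x" for y
    proof -
      have y': "y \<in> carrier M" "y \<ominus>\<^bsub>M\<^esub> x \<in> N"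
        using coset_mem[OF N x y] coset_eq_iff[OF N _ x] by auto
      have "a \<odot>\<^bsub>M\<^esub> (y \<ominus>\<^bsub>M\<^esub> x) \<in> N" using a y'(2) by (rule submodule.smult_closed[OF N])
      then have "a \<odot>\<^bsub>M\<^esub> y \<ominus>\<^bsub>M\<^esub> a \<odot>\<^bsub>M\<^esub> x \<in> N"
        using a x y'(1) by (simp add: a_minus_def smult_r_distr smult_r_minus)
      then show ?thesis using coset_eq_iff[OF N] a x y'(1) by simp
    qed
    then have "(\<Union>y\<in>N +>\<^bsub>M\<^esub> x. N +>\<^bsub>M\<^esub> (a \<odot>\<^bsub>M\<^esub> y)) = N +>\<^bsub>M\<^esub> (a \<odot>\<^bsub>M\<^esub> x)"
      using coset_self[OF N x] by blast
    then show ?thesis by (simp add: quotient_module_def)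
  qed
qed

lemma quotient_module_is_module:
  assumes N: "submodule R N M"
  shows "module R (quotient_module N)"
proof -
  note simps = quotient_module_simps[OF N]
  have neg: "\<exists>w\<in>carrier M. N +>\<^bsub>M\<^esub> (v \<oplus>\<^bsub>M\<^esub> w) = N +>\<^bsub>M\<^esub> \<zero>\<^bsub>M\<^esub>" if "v \<in> carrier M" for v
    using that by (intro bexI[of _ "\<ominus>\<^bsub>M\<^esub> v"]) (simp_all add: M.r_neg)
  show ?thesis
    by (rule module_criteria[OF R.is_cring])
       (auto simp: simps neg M.a_assoc M.a_comm M.a_lcomm smult_l_distr smult_r_distr smult_assoc1)
qed

text \<open>
  The map sends \<open>x\<close> to its classes in the fibres; it is onto by the Chinese remainder theorem.
\<close>

lemma surjects_onto_fibres:
  assumes inj: "inj_on \<mm> {..<n}"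
    and max: "\<And>i. i < n \<Longrightarrow> maximalideal (\<mm> i) R"
    and ne: "\<And>i. i < n \<Longrightarrow> ideal_smult R M (\<mm> i) \<noteq> carrier M"
  shows "surjects_onto_nonzero_factors R M n"
proof -
  let ?N = "\<lambda>i. ideal_smult R M (\<mm> i)"
  let ?Q = "\<lambda>i. quotient_module (?N i)"
  let ?h = "\<lambda>x. \<lambda>i\<in>{..<n}. ?N i +>\<^bsub>M\<^esub> x"
  have N: "submodule R (?N i) M" if "i < n" for i
    using ideal.Icarr[OF maximalideal.axioms(1)[OF max[OF that]]] by (intro ideal_smult_submodule) auto
  note simps = quotient_module_simps[OF N]
  have factor: "module R (?Q i) \<and> carrier (?Q i) \<noteq> {\<zero>\<^bsub>?Q i\<^esub>}" if i: "i < n" for i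
  proof
    show "module R (?Q i)" by (rule quotient_module_is_module[OF N[OF i]])
    obtain x where x: "x \<in> carrier M" "x \<notin> ?N i"
      using ne[OF i] submodule.subset[OF N[OF i]] by blast
    then have "?N i +>\<^bsub>M\<^esub> x \<noteq> ?N i +>\<^bsub>M\<^esub> \<zero>\<^bsub>M\<^esub>"
      using coset_eq_iff[OF N[OF i] x(1) M.zero_closed] by (simp add: a_minus_def a_inv_zero)
    moreover have "?N i +>\<^bsub>M\<^esub> x \<in> carrier (?Q i)" using x(1) by (simp add: simps(1)[OF i])
    ultimately show "carrier (?Q i) \<noteq> {\<zero>\<^bsub>?Q i\<^esub>}" using simps(4)[OF i] by auto
  qed
  have hom: "?h \<in> module_hom R M (prod_module {..<n} ?Q)"
    unfolding module_hom_def prod_module_def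
    by (auto simp: simps fun_eq_iff)
  have onto: "?h ` carrier M = carrier (prod_module {..<n} ?Q)"
  proof
    show "?h ` carrier M \<subseteq> carrier (prod_module {..<n} ?Q)"
      by (auto simp: prod_module_def simps)
    show "carrier (prod_module {..<n} ?Q) \<subseteq> ?h ` carrier M"
    proof
      fix g assume "g \<in> carrier (prod_module {..<n} ?Q)"
      then have g: "g \<in> (\<Pi>\<^sub>E i\<in>{..<n}. carrier (?Q i))" by (simp add: prod_module_def)
      have "\<forall>i\<in>{..<n}. \<exists>y. y \<in> carrier M \<and> g i = ?N i +>\<^bsub>M\<^esub> y"
      proof
        fix i assume i: "i \<in> {..<n}"
        then have "g i \<in> carrier (?Q i)" using g by (rule PiE_mem[rotated])
        then show "\<exists>y. y \<in> carrier M \<and> g i = ?N i +>\<^bsub>M\<^esub> y" using i by (auto simp: simps(1))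
      qed
      from bchoice[OF this] obtain y where y: "\<And>i. i < n \<Longrightarrow> y i \<in> carrier M"
        "\<And>i. i < n \<Longrightarrow> g i = ?N i +>\<^bsub>M\<^esub> y i" by auto
      \<comment> \<open>Reindex the representatives by the ideals, as the remainder theorem expects.\<close>
      let ?y = "\<lambda>\<nn>. y (the_inv_into {..<n} \<mm> \<nn>)"
      have y': "?y (\<mm> i) = y i" if "i < n" for i using that by (simp add: the_inv_into_f_f[OF inj])
      have "\<exists>x \<in> carrier M. \<forall>\<nn>\<in>\<mm> ` {..<n}. x \<ominus>\<^bsub>M\<^esub> ?y \<nn> \<in> ideal_smult R M \<nn>"
        using max y(1) y' by (intro chinese_remainder_fibres) auto
      then obtain x where x: "x \<in> carrier M"
        "\<And>\<nn>. \<nn> \<in> \<mm> ` {..<n} \<Longrightarrow> x \<ominus>\<^bsub>M\<^esub> ?y \<nn> \<in> ideal_smult R M \<nn>" by blast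
      have xy: "?N i +>\<^bsub>M\<^esub> x = g i" if i: "i < n" for i
      proof -
        have "x \<ominus>\<^bsub>M\<^esub> y i \<in> ?N i" using x(2)[of "\<mm> i"] y'[OF i] i by simp
        then show ?thesis using coset_eq_iff[OF N[OF i] x(1) y(1)[OF i]] y(2)[OF i] by simp
      qed
      have "?h x = g"
      proof
        fix i show "?h x i = g i"
          using xy PiE_arb[OF g] by (cases "i < n") auto
      qed
      then show "g \<in> ?h ` carrier M" using x(1) by blast
    qed
  qed
  show ?thesis
    unfolding surjects_onto_nonzero_factors_def
    by (rule exI[of _ ?Q], rule exI[of _ ?h]) (use factor hom onto in blast)
qed

lemma finite_nonzero_fibres:
  assumes "dual_Goldie_dim R M \<noteq> \<infinity>"
  shows "finite {\<mm> \<in> mSpec R. ideal_smult R M \<mm> \<noteq> carrier M}"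
proof (rule ccontr)
  assume "infinite {\<mm> \<in> mSpec R. ideal_smult R M \<mm> \<noteq> carrier M}"
  then obtain \<mm> :: "nat \<Rightarrow> 'a set" where m: "inj \<mm>"
    "range \<mm> \<subseteq> {\<mm> \<in> mSpec R. ideal_smult R M \<mm> \<noteq> carrier M}"
    using infinite_countable_subset by blast
  have "surjects_onto_nonzero_factors R M n" for n
    using m inj_on_subset[OF m(1)] by (intro surjects_onto_fibres[of \<mm>]) (auto simp: mSpec_def)
  then have "enat n \<le> dual_Goldie_dim R M" for n
    unfolding dual_Goldie_dim_def by (intro Sup_upper) blast
  then have "dual_Goldie_dim R M = \<infinity>"
    by (metis Suc_ile_eq enat.exhaust less_irrefl)
  then show False using assms by blast
qed

text \<open>
  Suppose that all fibres have dimension at most one, and let \<open>x\<close> be nonzero in each of the finitely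
  many nonzero fibres. If \<open>x\<close> does not generate \<open>M\<close>, it lies in a maximal submodule, which
  contains some \<open>\<mm>M\<close>. As \<open>x\<close> generates \<open>M\<close> modulo \<open>\<mm>M\<close>, that submodule is all of \<open>M\<close>, which is
  impossible.
\<close>

lemma S_set_nonempty:
  assumes fg: "module_fg R M" and nc: "\<not> module_cyclic R M" and gd: "dual_Goldie_dim R M \<noteq> \<infinity>"
  shows "S_set R M \<noteq> {}"
proof
  assume "S_set R M = {}"
  then have dim: "vectorspace.dim (R Quot \<mm>) (fibre R M \<mm>) < 2" if "maximalideal \<mm> R" for \<mm>
    using that unfolding S_set_def mSpec_def by (auto simp: not_le)
  define T where "T = {\<mm> \<in> mSpec R. ideal_smult R M \<mm> \<noteq> carrier M}"
  have T: "finite T" unfolding T_def by (rule finite_nonzero_fibres[OF gd])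
  have max: "maximalideal \<mm> R" if "\<mm> \<in> T" for \<mm> using that by (simp add: T_def mSpec_def)
  have N: "submodule R (ideal_smult R M \<mm>) M" if "maximalideal \<mm> R" for \<mm>
    using ideal.Icarr[OF maximalideal.axioms(1)[OF that]] by (intro ideal_smult_submodule) auto
  have "\<forall>\<mm>\<in>T. \<exists>y. y \<in> carrier M \<and> y \<notin> ideal_smult R M \<mm>"
    using submodule.subset[OF N[OF max]] unfolding T_def by blast
  from bchoice[OF this] obtain y
    where y: "\<And>\<mm>. \<mm> \<in> T \<Longrightarrow> y \<mm> \<in> carrier M" "\<And>\<mm>. \<mm> \<in> T \<Longrightarrow> y \<mm> \<notin> ideal_smult R M \<mm>" by blast
  obtain x where x: "x \<in> carrier M" "\<forall>\<mm>\<in>T. x \<ominus>\<^bsub>M\<^esub> y \<mm> \<in> ideal_smult R M \<mm>"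
    using chinese_remainder_fibres[OF T, of y] max y(1) by blast
  have x': "x \<notin> ideal_smult R M \<mm>" if "\<mm> \<in> T" for \<mm>
  proof
    assume "x \<in> ideal_smult R M \<mm>"
    then have "x \<ominus>\<^bsub>M\<^esub> (x \<ominus>\<^bsub>M\<^esub> y \<mm>) \<in> ideal_smult R M \<mm>"
      by (rule submodule_diff[OF N[OF max[OF that]]]) (use x(2) that in blast)
    also have "x \<ominus>\<^bsub>M\<^esub> (x \<ominus>\<^bsub>M\<^esub> y \<mm>) = y \<mm>"
      using x(1) y(1)[OF that] by (simp add: a_minus_def M.minus_add M.r_neg1 M.a_assoc[symmetric] M.r_neg)
    finally show False using y(2)[OF that] by blast
  qed
  have sx: "submodule R (span {x}) M" using x(1) by (intro span_is_submodule) auto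
  have xs: "x \<in> span {x}" using in_own_span[of "{x}"] x(1) by auto
  have "span {x} \<noteq> carrier M" using nc x(1) unfolding module_cyclic_def by blast
  then obtain L where L: "maximal_submodule L" "span {x} \<subseteq> L"
    using ex_maximal_submodule[OF fg sx] by blast
  obtain \<mm> where \<mm>: "maximalideal \<mm> R" "ideal_smult R M \<mm> \<subseteq> L"
    using maximal_submodule_ideal[OF L(1)] by blast
  have subL: "submodule R L M" "L \<noteq> carrier M" using L(1) unfolding maximal_submodule_def by auto
  interpret L: submodule R L M by (rule subL(1))
  have "\<mm> \<in> T" using \<mm> subL(2) L.subset unfolding T_def mSpec_def by blast
  have "carrier M \<subseteq> L"
  proof
    fix z assume z: "z \<in> carrier M"
    obtain r where r: "r \<in> carrier R" "z \<ominus>\<^bsub>M\<^esub> r \<odot>\<^bsub>M\<^esub> x \<in> ideal_smult R M \<mm>"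
      using fibre_line_if_dim_less_2[OF \<mm>(1) fg dim[OF \<mm>(1)] x(1) x'[OF \<open>\<mm> \<in> T\<close>] z] by blast
    have "(z \<ominus>\<^bsub>M\<^esub> r \<odot>\<^bsub>M\<^esub> x) \<oplus>\<^bsub>M\<^esub> r \<odot>\<^bsub>M\<^esub> x \<in> L"
      using r \<mm>(2) xs L(2) by (intro L.m_closed L.smult_closed) auto
    also have "(z \<ominus>\<^bsub>M\<^esub> r \<odot>\<^bsub>M\<^esub> x) \<oplus>\<^bsub>M\<^esub> r \<odot>\<^bsub>M\<^esub> x = z"
      using z r(1) x(1) by (simp add: a_minus_def M.a_assoc M.l_neg)
    finally show "z \<in> L" .
  qed
  then show False using subL(2) L.subset by blast
qed

end

section \<open>The induced Zariski topology\<close>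

lemma istopology_with_closed_point:
  assumes "z \<in> V"
  shows "istopology (\<lambda>U. U \<subseteq> V \<and> V - U \<in> {{}, {z}, V})"
  unfolding istopology_def
proof (intro conjI allI impI)
  fix S T assume S: "S \<subseteq> V \<and> V - S \<in> {{}, {z}, V}" and T: "T \<subseteq> V \<and> V - T \<in> {{}, {z}, V}"
  show "S \<inter> T \<subseteq> V" using S by blast
  have un: "A \<union> B \<in> {{}, {z}, V}" if "A \<in> {{}, {z}, V}" "B \<in> {{}, {z}, V}" for A B
    using that assms by fastforce
  have "V - S \<inter> T = (V - S) \<union> (V - T)" by (rule Diff_Int)
  then show "V - S \<inter> T \<in> {{}, {z}, V}" using un S T by presburger
next
  fix \<U> assume U: "\<forall>U\<in>\<U>. U \<subseteq> V \<and> V - U \<in> {{}, {z}, V}"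
  show "\<Union>\<U> \<subseteq> V" using U by blast
  show "V - \<Union>\<U> \<in> {{}, {z}, V}"
  proof (cases "\<forall>U\<in>\<U>. V - U = V")
    case True
    then have "V - \<Union>\<U> = V" by blast
    then show ?thesis by simp
  next
    case False
    then obtain U where "U \<in> \<U>" "V - U \<subseteq> {z}" using U by blast
    then have "V - \<Union>\<U> \<subseteq> {z}" by blast
    then show ?thesis by blast
  qed
qed

context module
begin

lemma fibre_topology_outside_S_set:
  assumes m: "\<mm> \<in> mSpec R" "\<mm> \<notin> S_set R M"
  shows "topspace (fibre_topology R M \<mm>) = carrier (fibre R M \<mm>)"
    and "closedin (fibre_topology R M \<mm>) Z \<longleftrightarrow> Z \<in> {{}, {\<zero>\<^bsub>fibre R M \<mm>\<^esub>}, carrier (fibre R M \<mm>)}"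
proof -
  let ?V = "carrier (fibre R M \<mm>)" and ?z = "\<zero>\<^bsub>fibre R M \<mm>\<^esub>"
  have max: "maximalideal \<mm> R" using m(1) by (simp add: mSpec_def)
  interpret V: vectorspace "R Quot \<mm>" "fibre R M \<mm>" by (rule fibre_vectorspace[OF max])
  have z: "?z \<in> ?V" by simp
  have op: "openin (fibre_topology R M \<mm>) U \<longleftrightarrow> U \<subseteq> ?V \<and> ?V - U \<in> {{}, {?z}, ?V}" for U
    unfolding fibre_topology_def Let_def using m(2) istopology_with_closed_point[OF z] by simp
  have "openin (fibre_topology R M \<mm>) ?V" unfolding op by simp
  then show top: "topspace (fibre_topology R M \<mm>) = ?V"
    using openin_subset op[of "topspace (fibre_topology R M \<mm>)"] by auto
  show "closedin (fibre_topology R M \<mm>) Z \<longleftrightarrow> Z \<in> {{}, {?z}, ?V}"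
    unfolding closedin_def top op
  proof
    assume Z: "Z \<subseteq> ?V \<and> ?V - Z \<subseteq> ?V \<and> ?V - (?V - Z) \<in> {{}, {?z}, ?V}"
    then have "?V - (?V - Z) = Z" by blast
    with Z show "Z \<in> {{}, {?z}, ?V}" by simp
  next
    assume "Z \<in> {{}, {?z}, ?V}"
    moreover from this z have "Z \<subseteq> ?V" by auto
    moreover from this have "?V - (?V - Z) = Z" by blast
    ultimately show "Z \<subseteq> ?V \<and> ?V - Z \<subseteq> ?V \<and> ?V - (?V - Z) \<in> {{}, {?z}, ?V}" by simp
  qed
qed

lemma topspace_fibre_topology:
  assumes fg: "module_fg R M" and m: "\<mm> \<in> mSpec R"
  shows "topspace (fibre_topology R M \<mm>) = carrier (fibre R M \<mm>)"
proof (cases "\<mm> \<in> S_set R M")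
  case True
  have max: "maximalideal \<mm> R" using m by (simp add: mSpec_def)
  interpret V: vectorspace "R Quot \<mm>" "fibre R M \<mm>" by (rule fibre_vectorspace[OF max])
  show ?thesis
    using V.closedin_zariski_topology(1)[OF fibre_fin_dim[OF max fg]] True
    by (simp add: fibre_topology_def Let_def)
next
  case False
  then show ?thesis using fibre_topology_outside_S_set(1)[OF m] by blast
qed

text \<open>
  Outside \<^const>\<open>S_set\<close> the union of the proper closed sets is at most the origin, whatever their
  number, which is why the bound on the cardinality is required in \<^const>\<open>S_set\<close> only.
\<close>

lemma fibre_closed_sets_do_not_cover:
  assumes fg: "module_fg R M" and m: "\<mm> \<in> mSpec R" and ne: "ideal_smult R M \<mm> \<noteq> carrier M"
    and inf: "\<mm> \<in> S_set R M \<Longrightarrow> infinite (carrier (R Quot \<mm>))"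
    and card: "\<mm> \<in> S_set R M \<Longrightarrow> |\<Z>| <o |carrier (R Quot \<mm>)|"
    and Z: "\<And>Z. Z \<in> \<Z> \<Longrightarrow> closedin (fibre_topology R M \<mm>) Z \<and> Z \<noteq> carrier (fibre R M \<mm>)"
  shows "\<exists>x \<in> carrier M. ideal_smult R M \<mm> +>\<^bsub>M\<^esub> x \<notin> \<Union>\<Z>"
proof -
  have max: "maximalideal \<mm> R" using m by (simp add: mSpec_def)
  interpret m: maximalideal \<mm> R by (rule max)
  interpret V: vectorspace "R Quot \<mm>" "fibre R M \<mm>" by (rule fibre_vectorspace[OF max])
  note simps = fibre_simps[OF m.is_ideal]
  have N: "submodule R (ideal_smult R M \<mm>) M" by (rule ideal_smult_submodule[OF m.a_subset])
  show ?thesis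
  proof (cases "\<mm> \<in> S_set R M")
    case True
    then have "\<And>Z. Z \<in> \<Z> \<Longrightarrow>
        closedin (zariski_topology (R Quot \<mm>) (fibre R M \<mm>)) Z \<and> Z \<noteq> carrier (fibre R M \<mm>)"
      using Z by (simp add: fibre_topology_def Let_def)
    from V.zariski_closed_sets_do_not_cover[OF fibre_fin_dim[OF max fg] inf[OF True] card[OF True] this]
    show ?thesis unfolding simps(1) by blast
  next
    case False
    obtain x where x: "x \<in> carrier M" "x \<notin> ideal_smult R M \<mm>"
      using ne submodule.subset[OF N] by blast
    then have nz: "ideal_smult R M \<mm> +>\<^bsub>M\<^esub> x \<noteq> \<zero>\<^bsub>fibre R M \<mm>\<^esub>"
      using coset_eq_iff[OF N x(1) M.zero_closed] by (simp add: simps(4) a_minus_def a_inv_zero)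
    have "Z \<subseteq> {\<zero>\<^bsub>fibre R M \<mm>\<^esub>}" if "Z \<in> \<Z>" for Z
      using Z[OF that] fibre_topology_outside_S_set(2)[OF m False, of Z] by auto
    then show ?thesis using x(1) nz by blast
  qed
qed

text \<open>
  The map \<open>q\<close> that induces the topology of \<open>M\<close>.
\<close>

definition fibre_point :: "'c \<Rightarrow> 'a set \<Rightarrow> 'c set" where
  "fibre_point x = (\<lambda>\<mm>\<in>mSpec R. ideal_smult R M \<mm> +>\<^bsub>M\<^esub> x)"

lemma induced_zariski_eq:
  "induced_zariski R M =
     pullback_topology (carrier M) fibre_point (product_topology (fibre_topology R M) (mSpec R))"
  unfolding induced_zariski_def fibre_point_def by (rule refl)

lemma coset_in_fibre:
  assumes "\<mm> \<in> mSpec R" "x \<in> carrier M"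
  shows "ideal_smult R M \<mm> +>\<^bsub>M\<^esub> x \<in> carrier (fibre R M \<mm>)"
  using fibre_simps(1)[OF maximalideal.axioms(1)] assms by (auto simp: mSpec_def)

lemma topspace_induced_zariski:
  assumes fg: "module_fg R M"
  shows "topspace (induced_zariski R M) = carrier M"
  unfolding induced_zariski_eq topspace_pullback_topology topspace_product_topology
  using coset_in_fibre by (auto simp: fibre_point_def topspace_fibre_topology[OF fg])

lemma continuous_map_fibre:
  assumes m: "\<mm> \<in> mSpec R"
  shows "continuous_map (induced_zariski R M) (fibre_topology R M \<mm>)
    (\<lambda>x. ideal_smult R M \<mm> +>\<^bsub>M\<^esub> x)"
proof -
  have "continuous_map (induced_zariski R M) (fibre_topology R M \<mm>) ((\<lambda>f. f \<mm>) \<circ> fibre_point)"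
    unfolding induced_zariski_eq
    by (rule continuous_map_pullback[OF continuous_map_product_projection[OF m]])
  moreover have "(\<lambda>f. f \<mm>) \<circ> fibre_point = (\<lambda>x. ideal_smult R M \<mm> +>\<^bsub>M\<^esub> x)"
    using m by (simp add: fibre_point_def fun_eq_iff)
  ultimately show ?thesis by simp
qed

text \<open>
  For the ideal \<open>\<mm>\<close> with \<open>\<mm>M \<subseteq> N\<close>, the set \<open>N\<close> is the preimage of its image in the fibre at \<open>\<mm>\<close>. That image
  is a hyperplane if \<open>\<mm>\<close> is in \<^const>\<open>S_set\<close>; otherwise the fibre has dimension one and the image is
  the origin. Both are closed.
\<close>

lemma closedin_maximal_submodule:
  assumes fg: "module_fg R M" and N: "maximal_submodule N"
  shows "closedin (induced_zariski R M) N"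
proof -
  obtain \<mm> where max: "maximalideal \<mm> R" and sub: "ideal_smult R M \<mm> \<subseteq> N"
    using maximal_submodule_ideal[OF N] by blast
  have m: "\<mm> \<in> mSpec R" using max by (simp add: mSpec_def)
  interpret m: maximalideal \<mm> R by (rule max)
  interpret V: vectorspace "R Quot \<mm>" "fibre R M \<mm>" by (rule fibre_vectorspace[OF max])
  note simps = fibre_simps[OF m.is_ideal]
  let ?\<pi> = "\<lambda>x. ideal_smult R M \<mm> +>\<^bsub>M\<^esub> x"
  have I: "submodule R (ideal_smult R M \<mm>) M" by (rule ideal_smult_submodule[OF m.a_subset])
  have subN: "submodule R N M" "N \<noteq> carrier M" using N unfolding maximal_submodule_def by auto
  interpret N: submodule R N M by (rule subN(1))
  have mem: "x \<in> N" if x: "x \<in> carrier M" and px: "?\<pi> x \<in> ?\<pi> ` N" for x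
  proof -
    obtain n where n: "n \<in> N" "?\<pi> x = ?\<pi> n" using px by blast
    have nM: "n \<in> carrier M" using n(1) N.subset by blast
    have "x \<ominus>\<^bsub>M\<^esub> n \<in> N" using coset_eq_iff[OF I x nM] n(2) sub by auto
    then have "(x \<ominus>\<^bsub>M\<^esub> n) \<oplus>\<^bsub>M\<^esub> n \<in> N" using n(1) by simp
    also have "(x \<ominus>\<^bsub>M\<^esub> n) \<oplus>\<^bsub>M\<^esub> n = x" using x nM by (simp add: a_minus_def M.a_assoc M.l_neg)
    finally show ?thesis .
  qed
  obtain e where e: "e \<in> carrier M" "e \<notin> N" using subN N.subset by blast
  have "closedin (fibre_topology R M \<mm>) (?\<pi> ` N)"
  proof (cases "\<mm> \<in> S_set R M")
    case True
    have W: "submodule (R Quot \<mm>) (?\<pi> ` N) (fibre R M \<mm>)"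
    proof (rule submodule.intro)
      show "?\<pi> ` N \<subseteq> carrier (fibre R M \<mm>)" using N.subset simps(1) by auto
      show "v \<oplus>\<^bsub>fibre R M \<mm>\<^esub> w \<in> ?\<pi> ` N" if vw: "v \<in> ?\<pi> ` N" "w \<in> ?\<pi> ` N" for v w
      proof -
        obtain a b where ab: "a \<in> N" "b \<in> N" "v = ?\<pi> a" "w = ?\<pi> b" using vw by blast
        then have "v \<oplus>\<^bsub>fibre R M \<mm>\<^esub> w = ?\<pi> (a \<oplus>\<^bsub>M\<^esub> b)"
          using simps(2) N.subset by blast
        then show ?thesis using ab by simp
      qed
      show "\<zero>\<^bsub>fibre R M \<mm>\<^esub> \<in> ?\<pi> ` N" unfolding simps(4) by (rule imageI[OF N.zero_closed])
      show "c \<odot>\<^bsub>fibre R M \<mm>\<^esub> v \<in> ?\<pi> ` N"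
        if cv: "c \<in> carrier (R Quot \<mm>)" "v \<in> ?\<pi> ` N" for c v
      proof -
        obtain r a where ra: "r \<in> carrier R" "c = \<mm> +> r" "a \<in> N" "v = ?\<pi> a"
          using cv by (auto simp: Quot_carrier)
        then have "c \<odot>\<^bsub>fibre R M \<mm>\<^esub> v = ?\<pi> (r \<odot>\<^bsub>M\<^esub> a)"
          using simps(3) N.subset by blast
        then show ?thesis using ra by simp
      qed
    qed (rule V.module_axioms)
    have "closedin (zariski_topology (R Quot \<mm>) (fibre R M \<mm>)) (?\<pi> ` N)"
    proof (rule V.closedin_zariski_hyperplane[OF fibre_fin_dim[OF max fg]])
      show "Module.submodule (?\<pi> ` N) (R Quot \<mm>) (fibre R M \<mm>)"
        using W V.submodule_iff by blast
      show "?\<pi> e \<in> carrier (fibre R M \<mm>)" using e(1) simps(1) by blast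
      show "?\<pi> e \<notin> ?\<pi> ` N" using mem[OF e(1)] e(2) by blast
      show "\<exists>k\<in>carrier (R Quot \<mm>). v \<ominus>\<^bsub>fibre R M \<mm>\<^esub> k \<odot>\<^bsub>fibre R M \<mm>\<^esub> ?\<pi> e \<in> ?\<pi> ` N"
        if v: "v \<in> carrier (fibre R M \<mm>)" for v
      proof -
        obtain y where y: "y \<in> carrier M" "v = ?\<pi> y" using v simps(1) by blast
        obtain r where r: "r \<in> carrier R" "y \<ominus>\<^bsub>M\<^esub> r \<odot>\<^bsub>M\<^esub> e \<in> N"
          using maximal_submodule_line[OF N e y(1)] by blast
        let ?n = "y \<ominus>\<^bsub>M\<^esub> r \<odot>\<^bsub>M\<^esub> e"
        have n: "?n \<in> carrier M" using r(2) N.subset by blast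
        have k: "\<mm> +> r \<in> carrier (R Quot \<mm>)" using r(1) by (auto simp: Quot_carrier)
        have "?n \<oplus>\<^bsub>M\<^esub> r \<odot>\<^bsub>M\<^esub> e = y"
          using y(1) r(1) e(1) by (simp add: a_minus_def M.a_assoc M.l_neg)
        then have "v = ?\<pi> ?n \<oplus>\<^bsub>fibre R M \<mm>\<^esub> (\<mm> +> r) \<odot>\<^bsub>fibre R M \<mm>\<^esub> ?\<pi> e"
          using simps(2)[OF n, of "r \<odot>\<^bsub>M\<^esub> e"] simps(3)[OF r(1) e(1)] r(1) e(1) y(2) by simp
        then have "v \<ominus>\<^bsub>fibre R M \<mm>\<^esub> (\<mm> +> r) \<odot>\<^bsub>fibre R M \<mm>\<^esub> ?\<pi> e = ?\<pi> ?n"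
          using coset_in_fibre[OF m n] coset_in_fibre[OF m e(1)] k
          by (simp add: a_minus_def V.M.a_assoc V.M.r_neg)
        then show ?thesis using r(2) k by (metis imageI)
      qed
    qed
    then show ?thesis using True by (simp add: fibre_topology_def Let_def)
  next
    case False
    then have dim: "vectorspace.dim (R Quot \<mm>) (fibre R M \<mm>) < 2"
      using m by (simp add: S_set_def)
    have "N \<subseteq> ideal_smult R M \<mm>"
    proof
      fix n assume n: "n \<in> N"
      show "n \<in> ideal_smult R M \<mm>"
      proof (rule ccontr)
        assume "n \<notin> ideal_smult R M \<mm>"
        then obtain r where r: "r \<in> carrier R" "e \<ominus>\<^bsub>M\<^esub> r \<odot>\<^bsub>M\<^esub> n \<in> ideal_smult R M \<mm>"
          using fibre_line_if_dim_less_2[OF max fg dim _ _ e(1)] n N.subset by blast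
        have nM: "n \<in> carrier M" using n N.subset by blast
        have "(e \<ominus>\<^bsub>M\<^esub> r \<odot>\<^bsub>M\<^esub> n) \<oplus>\<^bsub>M\<^esub> r \<odot>\<^bsub>M\<^esub> n \<in> N"
          using r n sub by (intro N.m_closed N.smult_closed) auto
        also have "(e \<ominus>\<^bsub>M\<^esub> r \<odot>\<^bsub>M\<^esub> n) \<oplus>\<^bsub>M\<^esub> r \<odot>\<^bsub>M\<^esub> n = e"
          using e(1) r(1) nM by (simp add: a_minus_def M.a_assoc M.l_neg)
        finally show False using e(2) by blast
      qed
    qed
    then have "?\<pi> n = \<zero>\<^bsub>fibre R M \<mm>\<^esub>" if "n \<in> N" for n
      using that N.subset coset_eq_iff[OF I, of n "\<zero>\<^bsub>M\<^esub>"]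
      by (auto simp: simps(4) a_minus_def a_inv_zero)
    then have "?\<pi> ` N = {\<zero>\<^bsub>fibre R M \<mm>\<^esub>}" using N.zero_closed by blast
    then show ?thesis using fibre_topology_outside_S_set(2)[OF m False] by simp
  qed
  from closedin_continuous_map_preimage[OF continuous_map_fibre[OF m] this]
  have "closedin (induced_zariski R M) {x \<in> carrier M. ?\<pi> x \<in> ?\<pi> ` N}"
    by (simp add: topspace_induced_zariski[OF fg])
  moreover have "{x \<in> carrier M. ?\<pi> x \<in> ?\<pi> ` N} = N" using mem N.subset by blast
  ultimately show ?thesis by simp
qed

text \<open>
  The complement of \<open>Z\<close> contains the preimage of a nonempty basic open box. A point of \<open>Z\<close> misses
  this box, so in some fibre it lies in the complement of the corresponding side of the box.
\<close>

lemma proper_closed_set_in_fibres: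
  assumes fg: "module_fg R M" and Z: "closedin (induced_zariski R M) Z" "Z \<noteq> carrier M"
  shows "\<exists>C. (\<forall>\<mm>\<in>mSpec R. closedin (fibre_topology R M \<mm>) (C \<mm>) \<and> C \<mm> \<noteq> carrier (fibre R M \<mm>)) \<and>
    (\<forall>z\<in>Z. \<exists>\<mm>\<in>mSpec R. ideal_smult R M \<mm> +>\<^bsub>M\<^esub> z \<in> C \<mm>)"
proof -
  note top = topspace_induced_zariski[OF fg]
  have ZM: "Z \<subseteq> carrier M" using closedin_subset[OF Z(1)] top by simp
  then obtain x where x: "x \<in> carrier M" "x \<notin> Z" using Z(2) by blast
  have "openin (induced_zariski R M) (carrier M - Z)" using Z(1) top unfolding closedin_def by simp
  then obtain W where W: "openin (product_topology (fibre_topology R M) (mSpec R)) W"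
    "carrier M - Z = fibre_point -` W \<inter> carrier M"
    unfolding induced_zariski_eq openin_pullback_topology by blast
  have "fibre_point x \<in> W" using W(2) x by blast
  with W(1)[unfolded openin_product_topology_alt]
  have "\<exists>U. finite {\<mm> \<in> mSpec R. U \<mm> \<noteq> topspace (fibre_topology R M \<mm>)} \<and>
      (\<forall>\<mm>\<in>mSpec R. openin (fibre_topology R M \<mm>) (U \<mm>)) \<and>
      fibre_point x \<in> Pi\<^sub>E (mSpec R) U \<and> Pi\<^sub>E (mSpec R) U \<subseteq> W"
    by (rule bspec)
  then obtain U where U: "\<forall>\<mm>\<in>mSpec R. openin (fibre_topology R M \<mm>) (U \<mm>)"
    "fibre_point x \<in> Pi\<^sub>E (mSpec R) U" "Pi\<^sub>E (mSpec R) U \<subseteq> W"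
    by (elim exE conjE)
  show ?thesis
  proof (intro exI[of _ "\<lambda>\<mm>. carrier (fibre R M \<mm>) - U \<mm>"] conjI ballI)
    fix \<mm> assume m: "\<mm> \<in> mSpec R"
    show "closedin (fibre_topology R M \<mm>) (carrier (fibre R M \<mm>) - U \<mm>)"
      using U(1) m by (metis closedin_diff closedin_topspace topspace_fibre_topology[OF fg m])
    have "fibre_point x \<mm> \<in> U \<mm>" using U(2) m by (rule PiE_mem)
    then have "ideal_smult R M \<mm> +>\<^bsub>M\<^esub> x \<in> U \<mm>" using m by (simp add: fibre_point_def)
    then show "carrier (fibre R M \<mm>) - U \<mm> \<noteq> carrier (fibre R M \<mm>)"
      using coset_in_fibre[OF m x(1)] by blast
  next
    fix z assume z: "z \<in> Z"
    then have "fibre_point z \<notin> W" using W(2) ZM by blast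
    then have "fibre_point z \<notin> Pi\<^sub>E (mSpec R) U" using U(3) by blast
    then obtain \<mm> where m: "\<mm> \<in> mSpec R" "ideal_smult R M \<mm> +>\<^bsub>M\<^esub> z \<notin> U \<mm>"
      by (auto simp: fibre_point_def PiE_iff)
    then show "\<exists>\<mm>\<in>mSpec R. ideal_smult R M \<mm> +>\<^bsub>M\<^esub> z \<in> carrier (fibre R M \<mm>) - U \<mm>"
      using coset_in_fibre[OF m(1)] z ZM by blast
  qed
qed

text \<open>
  In each nonzero fibre choose a class outside the closed sets that come from all members of \<open>\<Z>\<close>,
  and lift these finitely many classes to one element of \<open>M\<close>. A zero fibre cannot catch this element,
  since its only proper closed set is empty.
\<close>

lemma few_closed_sets_do_not_cover:
  assumes fg: "module_fg R M" and gd: "dual_Goldie_dim R M \<noteq> \<infinity>"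
    and inf: "\<And>\<mm>. \<mm> \<in> S_set R M \<Longrightarrow> infinite (carrier (R Quot \<mm>))"
    and card: "\<And>\<mm>. \<mm> \<in> S_set R M \<Longrightarrow> |\<Z>| <o |carrier (R Quot \<mm>)|"
    and Z: "\<And>Z. Z \<in> \<Z> \<Longrightarrow> closedin (induced_zariski R M) Z \<and> Z \<noteq> carrier M"
  shows "\<exists>x \<in> carrier M. x \<notin> \<Union>\<Z>"
proof -
  have "\<forall>Z\<in>\<Z>. \<exists>C. (\<forall>\<mm>\<in>mSpec R. closedin (fibre_topology R M \<mm>) (C \<mm>) \<and> C \<mm> \<noteq> carrier (fibre R M \<mm>)) \<and>
    (\<forall>z\<in>Z. \<exists>\<mm>\<in>mSpec R. ideal_smult R M \<mm> +>\<^bsub>M\<^esub> z \<in> C \<mm>)"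
    using proper_closed_set_in_fibres[OF fg] Z by blast
  from bchoice[OF this] obtain C where C: "\<forall>Z\<in>\<Z>.
    (\<forall>\<mm>\<in>mSpec R. closedin (fibre_topology R M \<mm>) (C Z \<mm>) \<and> C Z \<mm> \<noteq> carrier (fibre R M \<mm>)) \<and>
    (\<forall>z\<in>Z. \<exists>\<mm>\<in>mSpec R. ideal_smult R M \<mm> +>\<^bsub>M\<^esub> z \<in> C Z \<mm>)" by blast
  define T where "T = {\<mm> \<in> mSpec R. ideal_smult R M \<mm> \<noteq> carrier M}"
  have T: "finite T" unfolding T_def by (rule finite_nonzero_fibres[OF gd])
  have I: "submodule R (ideal_smult R M \<mm>) M" if "\<mm> \<in> mSpec R" for \<mm>
    using that ideal.Icarr[OF maximalideal.axioms(1)]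
    by (intro ideal_smult_submodule) (auto simp: mSpec_def)
  have "\<exists>x. x \<in> carrier M \<and> ideal_smult R M \<mm> +>\<^bsub>M\<^esub> x \<notin> \<Union>((\<lambda>Z. C Z \<mm>) ` \<Z>)" if m: "\<mm> \<in> T" for \<mm>
  proof -
    have "\<exists>x \<in> carrier M. ideal_smult R M \<mm> +>\<^bsub>M\<^esub> x \<notin> \<Union>((\<lambda>Z. C Z \<mm>) ` \<Z>)"
    proof (rule fibre_closed_sets_do_not_cover[OF fg])
      show "|(\<lambda>Z. C Z \<mm>) ` \<Z>| <o |carrier (R Quot \<mm>)|" if "\<mm> \<in> S_set R M"
        using card_of_image card[OF that] by (rule ordLeq_ordLess_trans)
    qed (use m inf C in \<open>auto simp: T_def\<close>)
    then show ?thesis by blast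
  qed
  then have "\<forall>\<mm>\<in>T. \<exists>x. x \<in> carrier M \<and> ideal_smult R M \<mm> +>\<^bsub>M\<^esub> x \<notin> \<Union>((\<lambda>Z. C Z \<mm>) ` \<Z>)"
    by (rule ballI)
  from bchoice[OF this] obtain y where y: "\<And>\<mm>. \<mm> \<in> T \<Longrightarrow> y \<mm> \<in> carrier M"
    "\<And>\<mm>. \<mm> \<in> T \<Longrightarrow> ideal_smult R M \<mm> +>\<^bsub>M\<^esub> y \<mm> \<notin> \<Union>((\<lambda>Z. C Z \<mm>) ` \<Z>)" by blast
  have "\<exists>x \<in> carrier M. \<forall>\<mm>\<in>T. x \<ominus>\<^bsub>M\<^esub> y \<mm> \<in> ideal_smult R M \<mm>"
    using y(1) by (intro chinese_remainder_fibres[OF T]) (auto simp: T_def mSpec_def)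
  then obtain x where x: "x \<in> carrier M" "\<And>\<mm>. \<mm> \<in> T \<Longrightarrow> x \<ominus>\<^bsub>M\<^esub> y \<mm> \<in> ideal_smult R M \<mm>" by blast
  have "x \<notin> Z" if ZZ: "Z \<in> \<Z>" for Z
  proof
    assume "x \<in> Z"
    then obtain \<mm> where m: "\<mm> \<in> mSpec R" "ideal_smult R M \<mm> +>\<^bsub>M\<^esub> x \<in> C Z \<mm>"
      using C ZZ by blast
    have Cm: "closedin (fibre_topology R M \<mm>) (C Z \<mm>)" "C Z \<mm> \<noteq> carrier (fibre R M \<mm>)"
      using C ZZ m(1) by auto
    show False
    proof (cases "\<mm> \<in> T")
      case True
      then have "ideal_smult R M \<mm> +>\<^bsub>M\<^esub> x = ideal_smult R M \<mm> +>\<^bsub>M\<^esub> y \<mm>"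
        using coset_eq_iff[OF I[OF m(1)] x(1) y(1)[OF True]] x(2)[OF True] by simp
      then show False using y(2)[OF True] m(2) ZZ by auto
    next
      case False
      then have all: "ideal_smult R M \<mm> = carrier M" using m(1) by (simp add: T_def)
      have "w = ideal_smult R M \<mm> +>\<^bsub>M\<^esub> x" if w: "w \<in> carrier (fibre R M \<mm>)" for w
      proof -
        obtain y where y: "y \<in> carrier M" "w = ideal_smult R M \<mm> +>\<^bsub>M\<^esub> y"
          using w fibre_simps(1)[OF maximalideal.axioms(1)] m(1) by (auto simp: mSpec_def)
        have "y \<ominus>\<^bsub>M\<^esub> x \<in> ideal_smult R M \<mm>" using all y(1) x(1) by simp
        then show ?thesis using coset_eq_iff[OF I[OF m(1)] y(1) x(1)] y(2) by simp
      qed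
      moreover have "C Z \<mm> \<subseteq> carrier (fibre R M \<mm>)"
        using closedin_subset[OF Cm(1)] topspace_fibre_topology[OF fg m(1)] by simp
      ultimately have "C Z \<mm> = carrier (fibre R M \<mm>)" using m(2) by blast
      then show False using Cm(2) by blast
    qed
  qed
  then show ?thesis using x(1) by blast
qed

text \<open>
  Enlarge each member of the cover to a maximal submodule.
\<close>

lemma closed_cover_of_submodule_cover:
  assumes fg: "module_fg R M" and C: "\<C> \<in> submodule_covers R M"
  shows "\<exists>\<D> \<in> closed_covers R M. |\<D>| \<le>o |\<C>|"
proof -
  have sub: "submodule R N M" "N \<noteq> carrier M" if "N \<in> \<C>" for N
    using C that submodule_iff unfolding submodule_covers_def by auto
  have "\<forall>N\<in>\<C>. \<exists>L. maximal_submodule L \<and> N \<subseteq> L"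
    using ex_maximal_submodule[OF fg sub] by blast
  from bchoice[OF this] obtain L where L: "\<And>N. N \<in> \<C> \<Longrightarrow> maximal_submodule (L N)"
    "\<And>N. N \<in> \<C> \<Longrightarrow> N \<subseteq> L N" by blast
  have "submodule R (L N) M \<and> L N \<noteq> carrier M" if "N \<in> \<C>" for N
    using L(1)[OF that] unfolding maximal_submodule_def by simp
  then have LM: "L N \<subseteq> carrier M" "L N \<noteq> carrier M" if "N \<in> \<C>" for N
    using that submodule.subset[of R "L N" M] by simp_all
  have "\<Union>\<C> = carrier M" using C unfolding submodule_covers_def by blast
  then have "\<Union>(L ` \<C>) = carrier M" using L(2) LM(1) by blast
  then have "L ` \<C> \<in> closed_covers R M"
    using closedin_maximal_submodule[OF fg L(1)] LM(2) unfolding closed_covers_def by blast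
  then show ?thesis using card_of_image by blast
qed

end

section \<open>Covers, cardinals and the Baire property\<close>

text \<open>
  Given dense open sets \<open>\<O>\<close> and a nonempty open set \<open>W\<close>, apply the hypothesis to the complements of
  the members of \<open>\<O>\<close> together with the complement of \<open>W\<close>.
\<close>

lemma cardinal_Baire_if_few_closed_sets_do_not_cover:
  fixes T :: "'x topology" and K :: "'k set" and \<kappa> :: "'l rel"
  assumes inf: "infinite K" and kappa: "\<kappa> =o |K|"
    and few: "\<And>\<Z>. |\<Z>| <o |K| \<Longrightarrow> (\<And>Z. Z \<in> \<Z> \<Longrightarrow> closedin T Z \<and> Z \<noteq> topspace T) \<Longrightarrow>
      \<exists>x \<in> topspace T. x \<notin> \<Union>\<Z>"
  shows "cardinal_Baire \<kappa> T"
  unfolding cardinal_Baire_def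
proof (intro allI impI)
  have "\<exists>x \<in> topspace T. x \<notin> \<Union>({} :: 'x set set)"
    using inf by (intro few card_of_finite_ordLess_infinite) auto
  then have ne: "U \<noteq> {}" if "T closure_of U = topspace T" for U using that by auto
  have compl: "closedin T (topspace T - U) \<and> topspace T - U \<noteq> topspace T"
    if "openin T U" "U \<noteq> {}" for U
    using that openin_subset[OF that(1)] by (auto simp: openin_closedin_eq)
  fix \<O> assume O: "(\<forall>U\<in>\<O>. openin T U \<and> T closure_of U = topspace T) \<and> |\<O>| <o \<kappa>"
  then have cardO: "|\<O>| <o |K|" using kappa ordLess_ordIso_trans by blast
  show "T closure_of (topspace T \<inter> \<Inter>\<O>) = topspace T"
    unfolding dense_intersects_open
  proof (intro allI impI)
    fix W assume W: "openin T W \<and> W \<noteq> {}"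
    let ?Z = "(\<lambda>U. topspace T - U) ` \<O> \<union> {topspace T - W}"
    have "\<exists>x \<in> topspace T. x \<notin> \<Union>?Z"
    proof (rule few)
      have "|(\<lambda>U. topspace T - U) ` \<O>| <o |K|"
        using card_of_image cardO by (rule ordLeq_ordLess_trans)
      moreover have "|{topspace T - W}| <o |K|"
        using inf by (intro card_of_finite_ordLess_infinite) auto
      ultimately show "|?Z| <o |K|" by (rule card_of_Un_ordLess_infinite[OF inf])
      show "closedin T Z \<and> Z \<noteq> topspace T" if "Z \<in> ?Z" for Z
        using that
      proof
        assume "Z \<in> (\<lambda>U. topspace T - U) ` \<O>"
        then obtain U where U: "U \<in> \<O>" "Z = topspace T - U" by (elim imageE)
        then have "openin T U" "U \<noteq> {}" using O ne by auto
        then show ?thesis using compl U(2) by simp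
      next
        assume "Z \<in> {topspace T - W}"
        then show ?thesis using compl W by simp
      qed
    qed
    then obtain x where x: "x \<in> topspace T" "x \<notin> \<Union>?Z" by (elim bexE)
    have "x \<in> U" if "U \<in> \<O>" for U using x that by auto
    moreover have "x \<in> W" using x by auto
    ultimately have "x \<in> (topspace T \<inter> \<Inter>\<O>) \<inter> W" using x(1) by simp
    then show "(topspace T \<inter> \<Inter>\<O>) \<inter> W \<noteq> {}" by blast
  qed
qed

text \<open>
  Irreducibility makes the complements of the members of the cover dense, and they have
  empty intersection.
\<close>

lemma not_cardinal_Baire_if_closed_cover:
  fixes T :: "'x topology" and \<mu> :: "'l rel"
  assumes D: "\<And>Z. Z \<in> \<D> \<Longrightarrow> closedin T Z \<and> Z \<noteq> topspace T" "\<Union>\<D> = topspace T"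
    and card: "|\<D>| <o \<mu>" and ne: "topspace T \<noteq> {}"
    and irreducible: "\<And>Y Z. closedin T Y \<Longrightarrow> Y \<noteq> topspace T \<Longrightarrow> closedin T Z \<Longrightarrow> Z \<noteq> topspace T \<Longrightarrow>
      Y \<union> Z \<noteq> topspace T"
  shows "\<not> cardinal_Baire \<mu> T"
proof
  assume B: "cardinal_Baire \<mu> T"
  let ?O = "(\<lambda>Z. topspace T - Z) ` \<D>"
  have dense: "openin T (topspace T - Z) \<and> T closure_of (topspace T - Z) = topspace T"
    if Z: "Z \<in> \<D>" for Z
  proof
    show "openin T (topspace T - Z)" using D(1)[OF Z] by (simp add: closedin_def)
    show "T closure_of (topspace T - Z) = topspace T"
      unfolding dense_intersects_open
    proof (intro allI impI)
      fix W assume W: "openin T W \<and> W \<noteq> {}"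
      then have "W \<subseteq> topspace T" by (simp add: openin_subset)
      moreover from this W have "topspace T - W \<noteq> topspace T" by blast
      moreover from W have "closedin T (topspace T - W)" by (auto simp: openin_closedin_eq)
      ultimately have "Z \<union> (topspace T - W) \<noteq> topspace T"
        using irreducible[of Z "topspace T - W"] D(1)[OF Z] by simp
      moreover have "Z \<subseteq> topspace T" using D(1)[OF Z] closedin_subset by blast
      ultimately show "(topspace T - Z) \<inter> W \<noteq> {}" by blast
    qed
  qed
  have "|?O| <o \<mu>" using card_of_image card by (rule ordLeq_ordLess_trans)
  moreover have "\<forall>U\<in>?O. openin T U \<and> T closure_of U = topspace T"
    using dense by (intro ballI) (elim imageE, simp)
  ultimately have "T closure_of (topspace T \<inter> \<Inter>?O) = topspace T"
    using B[unfolded cardinal_Baire_def, THEN spec, of ?O] by simp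
  moreover have "topspace T \<inter> \<Inter>?O = {}"
  proof -
    have "x \<notin> \<Inter>?O" if "x \<in> Z" "Z \<in> \<D>" for x Z using that by auto
    then show ?thesis using D(2) by blast
  qed
  ultimately show False using ne by (metis closure_of_empty)
qed

lemma min_card_ordIso:
  assumes "\<C> \<in> \<A>" "|\<C>| \<le>o r" "\<And>\<Z>. \<Z> \<in> \<A> \<Longrightarrow> r \<le>o |\<Z>|"
  shows "min_card \<A> =o r"
proof -
  have ne: "\<A> \<noteq> {}" using assms(1) by blast
  obtain \<Z> where "\<Z> \<in> \<A>" "min_card \<A> = |\<Z>|" using min_card(1)[OF ne] by blast
  then have "r \<le>o min_card \<A>" using assms(3) by simp
  moreover have "min_card \<A> \<le>o r"
    using min_card(2)[OF ne assms(1)] assms(2) by (rule ordLeq_transitive)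
  ultimately show ?thesis by (simp add: ordIso_iff_ordLeq)
qed

text \<open>
  The summand one is absorbed because the minimum is an infinite cardinal.
\<close>

lemma (in module) kappa_attained:
  assumes ne: "S_set R M \<noteq> {}"
    and inf: "\<And>\<mm>. \<mm> \<in> S_set R M \<Longrightarrow> infinite (carrier (R Quot \<mm>))"
  shows "\<exists>\<mm>\<in>S_set R M. kappa R M =o |carrier (R Quot \<mm>)| \<and>
    (\<forall>\<nn>\<in>S_set R M. |carrier (R Quot \<mm>)| \<le>o |carrier (R Quot \<nn>)| )"
proof -
  let ?A = "(\<lambda>\<mm>. carrier (R Quot \<mm>)) ` S_set R M"
  have A: "?A \<noteq> {}" using ne by simp
  obtain \<mm> where m: "\<mm> \<in> S_set R M" "min_card ?A = |carrier (R Quot \<mm>)|"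
    using min_card(1)[OF A] by blast
  have "Cinfinite |carrier (R Quot \<mm>)|"
    using inf[OF m(1)] by (simp add: cinfinite_def Field_card_of card_of_card_order_on)
  then have "|carrier (R Quot \<mm>)| +c cone =o |carrier (R Quot \<mm>)|"
    by (intro csum_absorb1 ordLess_imp_ordLeq) (simp_all add: Cfinite_ordLess_Cinfinite Cfinite_cone)
  then have "kappa R M =o |carrier (R Quot \<mm>)|" unfolding kappa_def m(2) .
  moreover have "|carrier (R Quot \<mm>)| \<le>o |carrier (R Quot \<nn>)|" if "\<nn> \<in> S_set R M" for \<nn>
    using min_card(2)[OF A, of "carrier (R Quot \<nn>)"] that m(2) by simp
  ultimately show ?thesis using m(1) by blast
qed

theorem theorem3p4:
  fixes R :: "('a, 'r) ring_scheme" and M :: "('a, 'b, 'm) module_scheme"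
  assumes "Module.module R M"
    and "module_fg R M"
    and "\<not> module_cyclic R M"
    and "dual_Goldie_dim R M \<noteq> \<infinity>"
    and "\<forall>\<mm> \<in> S_set R M. infinite (carrier (R Quot \<mm>))"
  shows "S_set R M \<noteq> {} \<and> closed_covers R M \<noteq> {} \<and> submodule_covers R M \<noteq> {} \<and>
    closed_covering_number R M =o kappa R M \<and>
    maximal_cardinal_Baire (kappa R M) (induced_zariski R M) \<and>
    covering_number R M =o kappa R M"
proof -
  interpret module R M by (rule assms(1))
  note fg = assms(2) and gd = assms(4)
  let ?T = "induced_zariski R M"
  note top = topspace_induced_zariski[OF fg]
  have inf: "infinite (carrier (R Quot \<mm>))" if "\<mm> \<in> S_set R M" for \<mm> using assms(5) that by blast
  have ne: "S_set R M \<noteq> {}" by (rule S_set_nonempty[OF fg assms(3) gd])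
  obtain \<mm> where m: "\<mm> \<in> S_set R M" and kappa: "kappa R M =o |carrier (R Quot \<mm>)|"
    and least: "\<And>\<nn>. \<nn> \<in> S_set R M \<Longrightarrow> |carrier (R Quot \<mm>)| \<le>o |carrier (R Quot \<nn>)|"
    using kappa_attained[OF ne inf] by blast
  let ?K = "carrier (R Quot \<mm>)"
  have infK: "infinite ?K" by (rule inf[OF m])
  have few: "\<exists>x \<in> topspace ?T. x \<notin> \<Union>\<Z>"
    if "|\<Z>| <o |?K|" "\<And>Z. Z \<in> \<Z> \<Longrightarrow> closedin ?T Z \<and> Z \<noteq> topspace ?T" for \<Z>
    using that ordLess_ordLeq_trans[OF that(1) least] unfolding top
    by (intro few_closed_sets_do_not_cover[OF fg gd inf])
  have max: "maximalideal \<mm> R" and dim: "2 \<le> vectorspace.dim (R Quot \<mm>) (fibre R M \<mm>)"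
    using m by (auto simp: S_set_def mSpec_def)
  obtain \<C> where C: "\<C> \<in> submodule_covers R M" "|\<C>| \<le>o |?K|"
    using submodule_cover_of_residue_cardinality[OF max fg dim infK] by blast
  obtain \<D> where "\<D> \<in> closed_covers R M" "|\<D>| \<le>o |\<C>|"
    using closed_cover_of_submodule_cover[OF fg C(1)] by blast
  then have D: "\<D> \<in> closed_covers R M" "|\<D>| \<le>o |?K|"
    using C(2) ordLeq_transitive by blast+
  have closed_ge: "|?K| \<le>o |\<Z>|" if Z: "\<Z> \<in> closed_covers R M" for \<Z>
  proof (rule ccontr)
    assume "\<not> |?K| \<le>o |\<Z>|"
    then have "|\<Z>| <o |?K|"
      by (rule not_ordLeq_iff_ordLess[OF card_of_Well_order card_of_Well_order, THEN iffD1])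
    then have "\<exists>x \<in> topspace ?T. x \<notin> \<Union>\<Z>"
      by (rule few) (use Z top in \<open>auto simp: closed_covers_def\<close>)
    then show False using Z top by (auto simp: closed_covers_def)
  qed
  have sub_ge: "|?K| \<le>o |\<Z>|" if "\<Z> \<in> submodule_covers R M" for \<Z>
    using closed_cover_of_submodule_cover[OF fg that] closed_ge ordLeq_transitive by blast
  have "closed_covering_number R M =o |?K|"
    unfolding closed_covering_number_def using D closed_ge by (rule min_card_ordIso)
  then have closed_number: "closed_covering_number R M =o kappa R M"
    using kappa ordIso_symmetric ordIso_transitive by blast
  have "covering_number R M =o |?K|"
    unfolding covering_number_def using C sub_ge by (rule min_card_ordIso)
  then have number: "covering_number R M =o kappa R M"
    using kappa ordIso_symmetric ordIso_transitive by blast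
  have "cardinal_Baire (kappa R M) ?T"
    using infK kappa few by (rule cardinal_Baire_if_few_closed_sets_do_not_cover)
  moreover have "\<not> cardinal_Baire \<mu> ?T" if mu: "kappa R M <o \<mu>" for \<mu> :: "('a set + unit) set rel"
  proof (rule not_cardinal_Baire_if_closed_cover)
    show "closedin ?T Z \<and> Z \<noteq> topspace ?T" if "Z \<in> \<D>" for Z
      using D(1) that top by (auto simp: closed_covers_def)
    show "\<Union>\<D> = topspace ?T" using D(1) top by (simp add: closed_covers_def)
    show "topspace ?T \<noteq> {}" using top M.zero_closed by blast
    have "|?K| <o \<mu>" using kappa mu ordIso_ordLess_trans ordIso_symmetric by blast
    with D(2) show "|\<D>| <o \<mu>" by (rule ordLeq_ordLess_trans)
    fix Y Z assume YZ: "closedin ?T Y" "Y \<noteq> topspace ?T" "closedin ?T Z" "Z \<noteq> topspace ?T"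
    have "\<exists>x \<in> topspace ?T. x \<notin> \<Union>{Y, Z}"
      by (rule few) (use YZ infK in \<open>auto intro: card_of_finite_ordLess_infinite\<close>)
    then show "Y \<union> Z \<noteq> topspace ?T" by blast
  qed
  ultimately have "maximal_cardinal_Baire (kappa R M) ?T"
    unfolding maximal_cardinal_Baire_def by blast
  then show ?thesis using ne closed_number number C(1) D(1) by blast
qed

end
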